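(* For all $\Lambda,\Lambda'\in\mathrm{Fin}(\mathbb Z)$ with $\Lambda\subseteq\Lambda'$, let $\varphi_{\Lambda',\Lambda}:\mathfrak A_\Lambda\to\mathfrak A_{\Lambda'}$ be defined, for all $A\in\mathfrak A_\Lambda$, by $\varphi_{\Lambda',\Lambda}(A):=A$ if $\Lambda=\Lambda'$ and $\varphi_{\Lambda',\Lambda}(A):=\pi_{\Lambda,\Lambda'}^{-1}(A\otimes1_{\Lambda'\setminus\Lambda})$ if $\Lambda\ne\Lambda'$. Then: (a) The family $\{\varphi_{\Lambda',\Lambda}\}_{\Lambda\subseteq\Lambda'}$ is a family of isotonies. (b) There exist a unital C*-algebra $\mathfrak A$, an increasing net of unital C*-subalgebras $(\widetilde{\mathfrak A}_\Lambda)_{\Lambda\in\mathrm{Fin}(\mathbb Z)}$ of $\mathfrak A$, and a family of *-isomorphisms $\varphi_\Lambda:\mathfrak A_\Lambda\to\widetilde{\mathfrak A}_\Lambda$, $\Lambda\in\mathrm{Fin}(\mathbb Z)$, satisfying $\varphi_{\Lambda'}\circ\varphi_{\Lambda',\Lambda}=\varphi_\Lambda$ for all $\Lambda,\Lambda'\in\mathrm{Fin}(\mathbb Z)$ with $\Lambda\subseteq\Lambda'$, such that $\mathfrak A$ is the norm closure of $\bigcup_{\Lambda\in\mathrm{Fin}(\mathbb Z)}\widetilde{\mathfrak A}_\Lambda$.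
   Context: $\mathrm{Fin}(\mathbb Z)$ is the set of nonempty finite subsets of $\mathbb Z$, directed by inclusion. For each $x\in\mathbb Z$, $\mathfrak A_x$ is a unital C*-algebra with identity $1_{\{x\}}$ and a fixed *-isomorphism $\xi_x:\mathfrak A_x\to\mathbb C^{2\times2}$. For $\Lambda=\{x_1<\dots<x_n\}\in\mathrm{Fin}(\mathbb Z)$, $\mathfrak A_\Lambda:=\mathfrak A_{x_1}\odot\cdots\odot\mathfrak A_{x_n}$ (algebraic tensor product; $\mathfrak A_\Lambda=\mathfrak A_{x_1}$ if $n=1$) is a unital C*-algebra with factorwise multiplication and involution and its unique C*-norm; its identity is $1_\Lambda=1_{\{x_1\}}\otimes\dots\otimes1_{\{x_n\}}$. For $\Lambda\subsetneq\Lambda'=\{x_1<\dots<x_{n'}\}$ with $n=\mathrm{card}(\Lambda)$, let $\sigma$ be the unique permutation of $\{1,\dots,n'\}$ such that $x_{\sigma(1)}<\dots<x_{\sigma(n)}$ are the elements of $\Lambda$ and $x_{\sigma(n+1)}<\dots<x_{\sigma(n')}$ those of $\Lambda'\setminus\Lambda$. $\pi_{\Lambda,\Lambda'}:\mathfrak A_{\Lambda'}\to\mathfrak A_\Lambda\odot\mathfrak A_{\Lambda'\setminus\Lambda}$ is the unique *-isomorphism with $\pi_{\Lambda,\Lambda'}(A_1\otimes\dots\otimes A_{n'})=(A_{\sigma(1)}\otimes\dots\otimes A_{\sigma(n)})\otimes(A_{\sigma(n+1)}\otimes\dots\otimes A_{\sigma(n')})$ for all $A_i\in\mathfrak A_{x_i}$.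 A family $\{\varphi_{\Lambda',\Lambda}:\mathfrak A_\Lambda\to\mathfrak A_{\Lambda'}\}_{\Lambda\subseteq\Lambda'}$ is called a family of isotonies if each $\varphi_{\Lambda',\Lambda}$ is an injective *-homomorphism, is unital ($\varphi_{\Lambda',\Lambda}(1_\Lambda)=1_{\Lambda'}$), and the cocycle condition $\varphi_{\Lambda'',\Lambda'}\circ\varphi_{\Lambda',\Lambda}=\varphi_{\Lambda'',\Lambda}$ holds for all $\Lambda\subseteq\Lambda'\subseteq\Lambda''$. Increasing net means $\widetilde{\mathfrak A}_\Lambda\subseteq\widetilde{\mathfrak A}_{\Lambda'}$ whenever $\Lambda\subseteq\Lambda'$. *)

theory Defs
  imports "HOL-Analysis.Analysis" "HOL-Algebra.Module" "HOL-Algebra.QuotRing" "HOL-Algebra.Subrings"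
begin

section \<open>Unital C*-algebras\<close>

text \<open>
  *-algebras and C*-algebras are explicit structures: the ring and module records of
  HOL-Algebra over the field of complex numbers, extended by an involution and a norm.
  Only the values of the operations on the carrier matter.
\<close>

definition complex_ring :: "complex ring" where
  "complex_ring = \<lparr>carrier = UNIV, mult = (*), one = 1, zero = 0, add = (+)\<rparr>"

record 'a star_alg = "(complex, 'a) module" +
  star :: "'a \<Rightarrow> 'a"

record 'a cstar_alg = "'a star_alg" +
  cnorm :: "'a \<Rightarrow> real"

locale unital_star_algebra = ring A + module complex_ring A
  for A :: "('a, 'm) star_alg_scheme" (structure) +
  assumes smult_mult_left:
      "\<lbrakk>x \<in> carrier A; y \<in> carrier A\<rbrakk> \<Longrightarrow> (c \<odot> x) \<otimes> y = c \<odot> (x \<otimes> y)"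
    and smult_mult_right:
      "\<lbrakk>x \<in> carrier A; y \<in> carrier A\<rbrakk> \<Longrightarrow> x \<otimes> (c \<odot> y) = c \<odot> (x \<otimes> y)"
    and star_closed: "x \<in> carrier A \<Longrightarrow> star A x \<in> carrier A"
    and star_star: "x \<in> carrier A \<Longrightarrow> star A (star A x) = x"
    and star_add:
      "\<lbrakk>x \<in> carrier A; y \<in> carrier A\<rbrakk> \<Longrightarrow> star A (x \<oplus> y) = star A x \<oplus> star A y"
    and star_smult: "x \<in> carrier A \<Longrightarrow> star A (c \<odot> x) = cnj c \<odot> star A x"
    and star_mult:
      "\<lbrakk>x \<in> carrier A; y \<in> carrier A\<rbrakk> \<Longrightarrow> star A (x \<otimes> y) = star A y \<otimes> star A x"

locale unital_cstar_algebra = unital_star_algebra A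
  for A :: "('a, 'm) cstar_alg_scheme" (structure) +
  assumes norm_nonneg: "x \<in> carrier A \<Longrightarrow> 0 \<le> cnorm A x"
    and norm_eq_zero: "x \<in> carrier A \<Longrightarrow> cnorm A x = 0 \<longleftrightarrow> x = \<zero>"
    and norm_triangle:
      "\<lbrakk>x \<in> carrier A; y \<in> carrier A\<rbrakk> \<Longrightarrow> cnorm A (x \<oplus> y) \<le> cnorm A x + cnorm A y"
    and norm_smult: "x \<in> carrier A \<Longrightarrow> cnorm A (c \<odot> x) = cmod c * cnorm A x"
    and norm_mult:
      "\<lbrakk>x \<in> carrier A; y \<in> carrier A\<rbrakk> \<Longrightarrow> cnorm A (x \<otimes> y) \<le> cnorm A x * cnorm A y"
    and cstar_identity: "x \<in> carrier A \<Longrightarrow> cnorm A (star A x \<otimes> x) = (cnorm A x)\<^sup>2"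
    and norm_complete:
      "\<lbrakk>\<And>n. s n \<in> carrier A;
        \<And>e. 0 < e \<Longrightarrow> \<exists>N. \<forall>m\<ge>N. \<forall>n\<ge>N. cnorm A (s m \<ominus> s n) < e\<rbrakk>
       \<Longrightarrow> \<exists>l\<in>carrier A. (\<lambda>n::nat. cnorm A (s n \<ominus> l)) \<longlonglongrightarrow> 0"

definition star_hom ::
  "('a, 'm) star_alg_scheme \<Rightarrow> ('b, 'n) star_alg_scheme \<Rightarrow> ('a \<Rightarrow> 'b) \<Rightarrow> bool" where
  "star_hom A B f \<longleftrightarrow>
     f \<in> carrier A \<rightarrow> carrier B \<and>
     (\<forall>x\<in>carrier A. \<forall>y\<in>carrier A. f (x \<oplus>\<^bsub>A\<^esub> y) = f x \<oplus>\<^bsub>B\<^esub> f y) \<and>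
     (\<forall>x\<in>carrier A. \<forall>y\<in>carrier A. f (x \<otimes>\<^bsub>A\<^esub> y) = f x \<otimes>\<^bsub>B\<^esub> f y) \<and>
     (\<forall>c. \<forall>x\<in>carrier A. f (c \<odot>\<^bsub>A\<^esub> x) = c \<odot>\<^bsub>B\<^esub> f x) \<and>
     (\<forall>x\<in>carrier A. f (star A x) = star B (f x))"

definition star_iso ::
  "('a, 'm) star_alg_scheme \<Rightarrow> ('b, 'n) star_alg_scheme \<Rightarrow> ('a \<Rightarrow> 'b) \<Rightarrow> bool" where
  "star_iso A B f \<longleftrightarrow> star_hom A B f \<and> bij_betw f (carrier A) (carrier B)"

definition norm_closure :: "('a, 'm) cstar_alg_scheme \<Rightarrow> 'a set \<Rightarrow> 'a set" where
  "norm_closure A S = {x \<in> carrier A. \<forall>e>0. \<exists>y\<in>S. cnorm A (x \<ominus>\<^bsub>A\<^esub> y) < e}"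

text \<open>A unital C*-subalgebra contains the identity of the ambient algebra
  (part of \<^const>\<open>subring\<close>).\<close>

definition unital_cstar_subalgebra :: "'a set \<Rightarrow> ('a, 'm) cstar_alg_scheme \<Rightarrow> bool" where
  "unital_cstar_subalgebra S A \<longleftrightarrow>
     subring S A \<and> (\<forall>c. \<forall>x\<in>S. c \<odot>\<^bsub>A\<^esub> x \<in> S) \<and> (\<forall>x\<in>S. star A x \<in> S) \<and>
     norm_closure A S \<subseteq> S"

definition mat2 :: "(complex^2^2) cstar_alg" where
  "mat2 =
     \<lparr>carrier = UNIV, mult = (**), one = mat 1, zero = 0, add = (+),
      smult = (\<lambda>c M. \<chi> i j. c * M $ i $ j),
      star = (\<lambda>M. \<chi> i j. cnj (M $ j $ i)),
      cnorm = (\<lambda>M. onorm ((*v) M))\<rparr>"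

section \<open>Algebraic tensor products of finite families\<close>

text \<open>
  The tensor product of the family \<open>A\<close> over the finite nonempty index set \<open>I\<close> is the free
  complex vector space on the tuples in \<open>\<Pi>\<^sub>E i\<in>I. carrier (A i)\<close> modulo the linear span of the
  multilinearity relations. The free vector space consists of the finitely supported functions
  on tuples; it carries the convolution product and the involution that extend the
  factorwise operations on tuples, and these pass to the quotient.
\<close>

type_synonym ('i, 'a) formal = "('i \<Rightarrow> 'a) \<Rightarrow> complex"
type_synonym ('i, 'a) tensor = "('i, 'a) formal set"

definition tuples :: "'i set \<Rightarrow> ('i \<Rightarrow> ('a, 'm) star_alg_scheme) \<Rightarrow> ('i \<Rightarrow> 'a) set" where
  "tuples I A = (\<Pi>\<^sub>E i\<in>I. carrier (A i))"

definition delta :: "('i \<Rightarrow> 'a) \<Rightarrow> ('i, 'a) formal" where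
  "delta a = (\<lambda>b. if b = a then 1 else 0)"

definition formal_sums ::
  "'i set \<Rightarrow> ('i \<Rightarrow> ('a, 'm) star_alg_scheme) \<Rightarrow> ('i, 'a) formal star_alg" where
  "formal_sums I A =
     \<lparr>carrier = {f. finite {a. f a \<noteq> 0} \<and> {a. f a \<noteq> 0} \<subseteq> tuples I A},
      mult = (\<lambda>f g c. \<Sum>(a, b) \<in> {(a, b). f a \<noteq> 0 \<and> g b \<noteq> 0 \<and>
                (\<lambda>i\<in>I. a i \<otimes>\<^bsub>A i\<^esub> b i) = c}. f a * g b),
      one = delta (\<lambda>i\<in>I. \<one>\<^bsub>A i\<^esub>),
      zero = (\<lambda>a. 0),
      add = (\<lambda>f g a. f a + g a),
      smult = (\<lambda>c f a. c * f a),
      star = (\<lambda>f c. \<Sum>a \<in> {a. f a \<noteq> 0 \<and> (\<lambda>i\<in>I. star (A i) (a i)) = c}. cnj (f a))\<rparr>"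

inductive_set tensor_null ::
  "'i set \<Rightarrow> ('i \<Rightarrow> ('a, 'm) star_alg_scheme) \<Rightarrow> ('i, 'a) formal set"
  for I :: "'i set" and A :: "'i \<Rightarrow> ('a, 'm) star_alg_scheme" where
  additive: "\<lbrakk>a \<in> tuples I A; i \<in> I; u \<in> carrier (A i); v \<in> carrier (A i)\<rbrakk> \<Longrightarrow>
    (\<lambda>b. delta (a(i := u \<oplus>\<^bsub>A i\<^esub> v)) b - delta (a(i := u)) b - delta (a(i := v)) b)
      \<in> tensor_null I A"
| homogeneous: "\<lbrakk>a \<in> tuples I A; i \<in> I; u \<in> carrier (A i)\<rbrakk> \<Longrightarrow>
    (\<lambda>b. delta (a(i := c \<odot>\<^bsub>A i\<^esub> u)) b - c * delta (a(i := u)) b) \<in> tensor_null I A"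
| zero: "(\<lambda>b. 0) \<in> tensor_null I A"
| add: "\<lbrakk>f \<in> tensor_null I A; g \<in> tensor_null I A\<rbrakk> \<Longrightarrow> (\<lambda>b. f b + g b) \<in> tensor_null I A"
| scale: "f \<in> tensor_null I A \<Longrightarrow> (\<lambda>b. c * f b) \<in> tensor_null I A"

definition tensor_star_alg ::
  "'i set \<Rightarrow> ('i \<Rightarrow> ('a, 'm) star_alg_scheme) \<Rightarrow> ('i, 'a) tensor star_alg" where
  "tensor_star_alg I A =
     (let F = formal_sums I A; N = tensor_null I A; Q = F Quot N in
      \<lparr>carrier = carrier Q, mult = mult Q, one = one Q, zero = zero Q, add = add Q,
       smult = (\<lambda>c X. \<Union>f\<in>X. N +>\<^bsub>F\<^esub> (c \<odot>\<^bsub>F\<^esub> f)),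
       star = (\<lambda>X. \<Union>f\<in>X. N +>\<^bsub>F\<^esub> star F f)\<rparr>)"

definition with_norm :: "'a star_alg \<Rightarrow> ('a \<Rightarrow> real) \<Rightarrow> 'a cstar_alg" where
  "with_norm A N = star_alg.extend A (cstar_alg.fields N)"

text \<open>The norm is the unique C*-norm; extensionality fixes its irrelevant values off the carrier.\<close>

definition tensor ::
  "'i set \<Rightarrow> ('i \<Rightarrow> ('a, 'm) star_alg_scheme) \<Rightarrow> ('i, 'a) tensor cstar_alg" where
  "tensor I A = with_norm (tensor_star_alg I A)
     (THE N. N \<in> extensional (carrier (tensor_star_alg I A)) \<and>
             unital_cstar_algebra (with_norm (tensor_star_alg I A) N))"

definition pure_tensor ::
  "'i set \<Rightarrow> ('i \<Rightarrow> ('a, 'm) star_alg_scheme) \<Rightarrow> ('i \<Rightarrow> 'a) \<Rightarrow> ('i, 'a) tensor" where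
  "pure_tensor I A a = tensor_null I A +>\<^bsub>formal_sums I A\<^esub> delta a"

text \<open>The product of two algebras is the case of the index set \<open>{True, False}\<close>, where
  \<open>True\<close> stands for the left factor.\<close>

definition tensor2 ::
  "('a, 'm) star_alg_scheme \<Rightarrow> ('a, 'm) star_alg_scheme \<Rightarrow> (bool, 'a) tensor cstar_alg" where
  "tensor2 A B = tensor UNIV (case_bool A B)"

definition pure_tensor2 ::
  "('a, 'm) star_alg_scheme \<Rightarrow> ('a, 'm) star_alg_scheme \<Rightarrow> 'a \<Rightarrow> 'a \<Rightarrow> (bool, 'a) tensor" where
  "pure_tensor2 A B a b = pure_tensor UNIV (case_bool A B) (case_bool a b)"

section \<open>Local algebras and isotonies\<close>

definition Fin_int :: "int set set" where
  "Fin_int = {L. finite L \<and> L \<noteq> {}}"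

definition local_alg ::
  "(int \<Rightarrow> ('a, 'm) star_alg_scheme) \<Rightarrow> int set \<Rightarrow> (int, 'a) tensor cstar_alg" where
  "local_alg A L = tensor L A"

text \<open>
  Tuples are indexed by the sites themselves. Hence the factors \<open>A\<^sub>\<sigma>\<^sub>(\<^sub>1\<^sub>), \<dots>, A\<^sub>\<sigma>\<^sub>(\<^sub>n\<^sub>)\<close>
  at the sites of \<open>L\<close>, in increasing order, form the restriction of the tuple to \<open>L\<close>, and
  the remaining ones its restriction to \<open>M - L\<close>.
\<close>

definition splitting ::
  "(int \<Rightarrow> ('a, 'm) star_alg_scheme) \<Rightarrow> int set \<Rightarrow> int set \<Rightarrow>
    (int, 'a) tensor \<Rightarrow> (bool, (int, 'a) tensor) tensor" where
  "splitting A L M =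
     (THE p. p \<in> extensional (carrier (local_alg A M)) \<and>
        star_iso (local_alg A M) (tensor2 (local_alg A L) (local_alg A (M - L))) p \<and>
        (\<forall>a\<in>tuples M A.
           p (pure_tensor M A a) =
             pure_tensor2 (local_alg A L) (local_alg A (M - L))
               (pure_tensor L A (restrict a L)) (pure_tensor (M - L) A (restrict a (M - L)))))"

text \<open>As in \<open>\<phi>\<^bsub>M,L\<^esub> : A\<^sub>L \<rightarrow> A\<^sub>M\<close>, the larger set comes first.\<close>

definition isotony ::
  "(int \<Rightarrow> ('a, 'm) star_alg_scheme) \<Rightarrow> int set \<Rightarrow> int set \<Rightarrow>
    (int, 'a) tensor \<Rightarrow> (int, 'a) tensor" where
  "isotony A M L a =
     (if L = M then a
      else inv_into (carrier (local_alg A M)) (splitting A L M)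
             (pure_tensor2 (local_alg A L) (local_alg A (M - L)) a \<one>\<^bsub>local_alg A (M - L)\<^esub>))"

definition family_of_isotonies ::
  "(int set \<Rightarrow> ('b, 'm) star_alg_scheme) \<Rightarrow> (int set \<Rightarrow> int set \<Rightarrow> 'b \<Rightarrow> 'b) \<Rightarrow> bool" where
  "family_of_isotonies B \<phi> \<longleftrightarrow>
     (\<forall>L\<in>Fin_int. \<forall>M\<in>Fin_int. L \<subseteq> M \<longrightarrow>
        star_hom (B L) (B M) (\<phi> M L) \<and> inj_on (\<phi> M L) (carrier (B L)) \<and>
        \<phi> M L \<one>\<^bsub>B L\<^esub> = \<one>\<^bsub>B M\<^esub>) \<and>
     (\<forall>L\<in>Fin_int. \<forall>M\<in>Fin_int. \<forall>K\<in>Fin_int. L \<subseteq> M \<longrightarrow> M \<subseteq> K \<longrightarrow>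
        (\<forall>a\<in>carrier (B L). \<phi> K M (\<phi> M L a) = \<phi> K L a))"

text \<open>
  An element type for the algebra generated by all local algebras: it has room for
  the equivalence classes of Cauchy sequences of pairs of a set \<open>L\<close> and an element of \<open>A\<^sub>L\<close>.
\<close>

type_synonym 'a quasilocal = "(nat \<Rightarrow> int set \<times> (int, 'a) tensor) set"

end

theory Submission
  imports Defs
begin

text \<open>
  Kronecker products of the matrices \<open>\<xi> x a\<close> identify every tensor product with a full matrix
  algebra: formal sums of tuples map linearly onto matrices, and the kernel is exactly the span of
  the multilinearity relations, because each tuple reduces to tuples of matrix units. Under this
  identification the isotony of \<open>L \<subseteq> M\<close> becomes \<open>m \<mapsto> m \<otimes> 1\<close>.

  A matrix over the configurations on a finite set \<open>L\<close> of sites acts on the Hilbert space of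
  square-summable functions of configurations on all of \<open>\<int>\<close> by changing the configuration on \<open>L\<close>
  only. Tensoring with the identity does not change this operator, so the local algebras embed
  compatibly into the bounded operators. The isotony laws follow from injectivity of these
  embeddings, and the norm closure of the union of their ranges is the required C*-algebra.
\<close>

section \<open>The Hilbert space \<open>l2\<close>\<close>

text \<open>The inner product on \<open>l2\<close> is the real part of the Hermitian one, so bounded
  operators are a priori only real-linear. Multiplication by a complex number is therefore itself an
  operator, \<open>scalar_op c\<close>, and complex linearity appears as commutation with all of
  these. On complex-linear operators the real and the Hermitian adjoint coincide, so the C*-identity
  can be proved in the real setting.

  The space has one basis vector for every configuration on the whole lattice, uncountably many.
  Thus no reference configuration at infinity has to be selected, as an infinite tensor product of
  vectors would demand; a local operator simply leaves the remaining sites alone. Once all local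
  algebras act on one space, the inductive limit is a directed union of sets of operators and its
  completion is a topological closure.

  The index set of the matrices is a parameter throughout. A tensor product of matrix models is then
  again a matrix model, and the same lemmas serve both for the product over the sites of a region
  and for the product of two complementary regions.\<close>

typedef 'k l2 = "{f :: 'k \<Rightarrow> complex. (\<lambda>k. (cmod (f k))\<^sup>2) summable_on UNIV}"
  morphisms l2_nth Abs_l2
  by (rule exI[of _ "\<lambda>_. 0"]) simp

setup_lifting type_definition_l2

lemma l2_eqI: "(\<And>k. l2_nth x k = l2_nth y k) \<Longrightarrow> x = y"
  by (metis ext l2_nth_inject)

lemma l2_summable: "(\<lambda>k. (cmod (l2_nth x k))\<^sup>2) summable_on UNIV"
  using l2_nth[of x] by simp

lemma square_summable_add:
  assumes "(\<lambda>k. (cmod (f k))\<^sup>2) summable_on UNIV" "(\<lambda>k. (cmod (g k))\<^sup>2) summable_on UNIV"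
  shows "(\<lambda>k. (cmod (f k + g k))\<^sup>2) summable_on UNIV"
proof (rule summable_on_comparison_test)
  show "(\<lambda>k. 2 * (cmod (f k))\<^sup>2 + 2 * (cmod (g k))\<^sup>2) summable_on UNIV"
    by (intro summable_on_add summable_on_cmult_right assms)
  fix k
  have "(cmod (f k + g k))\<^sup>2 \<le> (cmod (f k) + cmod (g k))\<^sup>2"
    by (intro power_mono norm_triangle_ineq) auto
  also have "\<dots> \<le> 2 * (cmod (f k))\<^sup>2 + 2 * (cmod (g k))\<^sup>2"
    using sum_squares_bound[of "cmod (f k)" "cmod (g k)"] by (simp add: power2_sum)
  finally show "(cmod (f k + g k))\<^sup>2 \<le> 2 * (cmod (f k))\<^sup>2 + 2 * (cmod (g k))\<^sup>2" .
qed simp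

lemma square_summable_cmult:
  assumes "(\<lambda>k. (cmod (f k))\<^sup>2) summable_on UNIV"
  shows "(\<lambda>k. (cmod (c * f k))\<^sup>2) summable_on UNIV"
  by (simp add: norm_mult power_mult_distrib summable_on_cmult_right assms)

instantiation l2 :: (type) real_vector
begin

lift_definition zero_l2 :: "'a l2" is "\<lambda>_. 0" by simp
lift_definition plus_l2 :: "'a l2 \<Rightarrow> 'a l2 \<Rightarrow> 'a l2" is "\<lambda>f g k. f k + g k"
  by (rule square_summable_add)
lift_definition uminus_l2 :: "'a l2 \<Rightarrow> 'a l2" is "\<lambda>f k. - f k" by simp
lift_definition minus_l2 :: "'a l2 \<Rightarrow> 'a l2 \<Rightarrow> 'a l2" is "\<lambda>f g k. f k - g k"
  using square_summable_add[of _ "\<lambda>k. - g k" for g] by fastforce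
lift_definition scaleR_l2 :: "real \<Rightarrow> 'a l2 \<Rightarrow> 'a l2" is "\<lambda>r f k. complex_of_real r * f k"
  by (rule square_summable_cmult)

instance
  by standard (transfer; simp add: algebra_simps)+

end

lemma l2_nth_simps [simp]:
  "l2_nth 0 k = 0" "l2_nth (x + y) k = l2_nth x k + l2_nth y k" "l2_nth (- x) k = - l2_nth x k"
  "l2_nth (x - y) k = l2_nth x k - l2_nth y k" "l2_nth (r *\<^sub>R x) k = r * l2_nth x k"
  by (transfer; simp)+

lemma l2_inner_summable: "(\<lambda>k. inner (l2_nth x k) (l2_nth y k)) summable_on UNIV"
proof -
  have "(\<lambda>k. norm (inner (l2_nth x k) (l2_nth y k))) summable_on UNIV"
  proof (rule summable_on_comparison_test)
    show "(\<lambda>k. (cmod (l2_nth x k))\<^sup>2 + (cmod (l2_nth y k))\<^sup>2) summable_on UNIV"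
      by (intro summable_on_add l2_summable)
    fix k
    have "norm (inner (l2_nth x k) (l2_nth y k)) \<le> cmod (l2_nth x k) * cmod (l2_nth y k)"
      by (simp add: Cauchy_Schwarz_ineq2)
    also have "\<dots> \<le> (cmod (l2_nth x k))\<^sup>2 + (cmod (l2_nth y k))\<^sup>2"
      using sum_squares_bound[of "cmod (l2_nth x k)" "cmod (l2_nth y k)"]
        mult_nonneg_nonneg[OF norm_ge_zero norm_ge_zero, of "l2_nth x k" "l2_nth y k"]
      by linarith
    finally show "norm (inner (l2_nth x k) (l2_nth y k)) \<le> (cmod (l2_nth x k))\<^sup>2 + (cmod (l2_nth y k))\<^sup>2" .
  qed simp
  then show ?thesis
    by (rule abs_summable_summable)
qed

instantiation l2 :: (type) real_inner
begin

definition inner_l2 :: "'a l2 \<Rightarrow> 'a l2 \<Rightarrow> real" where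
  "inner_l2 x y = (\<Sum>\<^sub>\<infinity>k. inner (l2_nth x k) (l2_nth y k))"
definition norm_l2 :: "'a l2 \<Rightarrow> real" where
  "norm_l2 x = sqrt (inner x x)"
definition dist_l2 :: "'a l2 \<Rightarrow> 'a l2 \<Rightarrow> real" where
  "dist_l2 x y = norm (x - y)"
definition sgn_l2 :: "'a l2 \<Rightarrow> 'a l2" where
  "sgn_l2 x = x /\<^sub>R norm x"
definition uniformity_l2 :: "('a l2 \<times> 'a l2) filter" where
  "uniformity_l2 = (INF e\<in>{0<..}. principal {(x, y). dist x y < e})"
definition open_l2 :: "'a l2 set \<Rightarrow> bool" where
  "open_l2 U = (\<forall>x\<in>U. \<forall>\<^sub>F (x', y) in uniformity. x' = x \<longrightarrow> y \<in> U)"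

instance
proof
  fix x y z :: "'a l2" and r :: real
  show "inner x y = inner y x"
    by (simp add: inner_l2_def inner_commute)
  show "inner (x + y) z = inner x z + inner y z"
    by (simp add: inner_l2_def inner_add_left infsum_add l2_inner_summable)
  show "inner (r *\<^sub>R x) y = r * inner x y"
    by (simp add: inner_l2_def infsum_cmult_right' flip: scaleR_conv_of_real)
  show "0 \<le> inner x x"
    by (simp add: inner_l2_def infsum_nonneg)
  show "inner x x = 0 \<longleftrightarrow> x = 0"
  proof
    assume "inner x x = 0"
    then have "inner (l2_nth x k) (l2_nth x k) = 0" for k
      using nonneg_infsum_le_0D[of "\<lambda>k. inner (l2_nth x k) (l2_nth x k)" UNIV k] l2_inner_summable
      unfolding inner_l2_def by (metis UNIV_I inner_ge_zero order_refl)
    then show "x = 0"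
      by (intro l2_eqI) simp
  qed (simp add: inner_l2_def)
qed (simp_all add: norm_l2_def dist_l2_def sgn_l2_def uniformity_l2_def open_l2_def)

end

lemma l2_norm_square: "(norm x)\<^sup>2 = (\<Sum>\<^sub>\<infinity>k. (cmod (l2_nth x k))\<^sup>2)"
proof -
  have "(norm x)\<^sup>2 = inner x x"
    by (rule power2_norm_eq_inner)
  then show ?thesis
    by (simp add: inner_l2_def dot_square_norm)
qed

lemma l2_sum_le: "finite F \<Longrightarrow> (\<Sum>k\<in>F. (cmod (l2_nth x k))\<^sup>2) \<le> (norm x)\<^sup>2"
  unfolding l2_norm_square
  by (intro finite_sum_le_infsum l2_summable) auto

lemma l2_nth_le_norm: "cmod (l2_nth x k) \<le> norm x"
  using l2_sum_le[of "{k}" x] by (simp add: power2_le_iff_abs_le)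

text \<open>Bounding finite partial sums is enough, which allows limits and reindexings to be
  carried out in finite sums.\<close>

lemma l2_norm_le:
  assumes "\<And>F. finite F \<Longrightarrow> (\<Sum>k\<in>F. (cmod (l2_nth x k))\<^sup>2) \<le> c\<^sup>2" "0 \<le> c"
  shows "norm x \<le> c"
proof -
  have "(norm x)\<^sup>2 \<le> c\<^sup>2"
    unfolding l2_norm_square
    by (intro infsum_le_finite_sums l2_summable assms)
  then show ?thesis
    using assms(2) by (rule power2_le_imp_le)
qed

text \<open>Coordinates converge because the norm dominates them. Norm convergence to the pointwise
  limit is then obtained on finite sets of coordinates, with bounds that do not depend on the
  set.\<close>

instance l2 :: (type) complete_space
proof
  fix X :: "nat \<Rightarrow> 'a l2"
  assume X: "Cauchy X"
  have "Cauchy (\<lambda>n. l2_nth (X n) k)" for k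
  proof (rule metric_CauchyI)
    fix e :: real assume "0 < e"
    then obtain N where N: "\<forall>m\<ge>N. \<forall>n\<ge>N. dist (X m) (X n) < e"
      using X by (meson metric_CauchyD)
    have "dist (l2_nth (X m) k) (l2_nth (X n) k) \<le> dist (X m) (X n)" for m n
      using l2_nth_le_norm[of "X m - X n" k] by (simp add: dist_norm)
    then show "\<exists>N. \<forall>m\<ge>N. \<forall>n\<ge>N. dist (l2_nth (X m) k) (l2_nth (X n) k) < e"
      using N by (meson le_less_trans)
  qed
  then have "\<forall>k. \<exists>l. (\<lambda>n. l2_nth (X n) k) \<longlonglongrightarrow> l"
    by (simp add: Cauchy_convergent_iff convergent_def)
  then have "\<exists>f. \<forall>k. (\<lambda>n. l2_nth (X n) k) \<longlonglongrightarrow> f k"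
    by (rule choice)
  then obtain f where f: "\<And>k. (\<lambda>n. l2_nth (X n) k) \<longlonglongrightarrow> f k"
    by blast
  \<comment> \<open>One \<open>N\<close> serves all finite \<open>F\<close>: the Cauchy estimate is
    restricted to \<open>F\<close> and then \<open>m\<close> tends to infinity in a finite
    sum.\<close>
  have tail: "\<exists>N. \<forall>n\<ge>N. \<forall>F. finite F \<longrightarrow> (\<Sum>k\<in>F. (cmod (f k - l2_nth (X n) k))\<^sup>2) \<le> e\<^sup>2"
    if "0 < e" for e
  proof -
    obtain N where N: "\<forall>m\<ge>N. \<forall>n\<ge>N. dist (X m) (X n) < e"
      using X \<open>0 < e\<close> by (meson metric_CauchyD)
    have "(\<Sum>k\<in>F. (cmod (f k - l2_nth (X n) k))\<^sup>2) \<le> e\<^sup>2" if "n \<ge> N" "finite F" for n F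
    proof (rule LIMSEQ_le_const2)
      show "(\<lambda>m. \<Sum>k\<in>F. (cmod (l2_nth (X m) k - l2_nth (X n) k))\<^sup>2)
          \<longlonglongrightarrow> (\<Sum>k\<in>F. (cmod (f k - l2_nth (X n) k))\<^sup>2)"
        by (intro tendsto_intros f)
      show "\<exists>M. \<forall>m\<ge>M. (\<Sum>k\<in>F. (cmod (l2_nth (X m) k - l2_nth (X n) k))\<^sup>2) \<le> e\<^sup>2"
      proof (intro exI allI impI)
        fix m assume "N \<le> m"
        then have "norm (X m - X n) \<le> e"
          using N \<open>N \<le> n\<close> by (force simp: dist_norm)
        then have "(norm (X m - X n))\<^sup>2 \<le> e\<^sup>2"
          by (simp add: power_mono)
        then show "(\<Sum>k\<in>F. (cmod (l2_nth (X m) k - l2_nth (X n) k))\<^sup>2) \<le> e\<^sup>2"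
          using l2_sum_le[OF \<open>finite F\<close>, of "X m - X n"] by simp
      qed
    qed
    then show ?thesis by blast
  qed
  have diff: "(\<lambda>k. (cmod (f k - l2_nth (X n) k))\<^sup>2) summable_on UNIV"
    if "\<forall>F. finite F \<longrightarrow> (\<Sum>k\<in>F. (cmod (f k - l2_nth (X n) k))\<^sup>2) \<le> e" for n e
    using that by (intro nonneg_bdd_above_summable_on bdd_aboveI2[where M = e]) auto
  \<comment> \<open>The limit \<open>f\<close> is square-summable as the sum of
    \<open>f - X n0\<close> and \<open>X n0\<close>; any radius would do here, and 1 is
    taken.\<close>
  obtain n0 where "\<forall>F. finite F \<longrightarrow> (\<Sum>k\<in>F. (cmod (f k - l2_nth (X n0) k))\<^sup>2) \<le> 1\<^sup>2"
    using tail[of 1] by fastforce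
  from square_summable_add[OF diff[OF this] l2_summable[of "X n0"]]
  have "(\<lambda>k. (cmod (f k))\<^sup>2) summable_on UNIV"
    by simp
  then have nth: "l2_nth (Abs_l2 f) = f"
    by (simp add: Abs_l2_inverse)
  have "X \<longlonglongrightarrow> Abs_l2 f"
  proof (rule metric_LIMSEQ_I)
    fix e :: real assume "0 < e"
    then obtain N where N: "\<forall>n\<ge>N. \<forall>F. finite F \<longrightarrow> (\<Sum>k\<in>F. (cmod (f k - l2_nth (X n) k))\<^sup>2) \<le> (e/2)\<^sup>2"
      using tail[of "e/2"] by auto
    have "dist (X n) (Abs_l2 f) < e" if "n \<ge> N" for n
    proof -
      have "norm (Abs_l2 f - X n) \<le> e/2"
        using N that \<open>0 < e\<close> by (intro l2_norm_le) (auto simp: nth)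
      then show ?thesis
        using \<open>0 < e\<close> by (simp add: dist_norm norm_minus_commute)
    qed
    then show "\<exists>N. \<forall>n\<ge>N. dist (X n) (Abs_l2 f) < e" by blast
  qed
  then show "convergent X"
    by (rule convergentI)
qed

instance l2 :: (type) banach ..

section \<open>Operators on \<open>l2\<close>\<close>

text \<open>Indices form a set rather than a type because configurations on different regions share
  one type. Vanishing off \<open>K\<close> makes equality of matrices an equality of
  functions.\<close>

definition mat_alg :: "'k set \<Rightarrow> ('k \<Rightarrow> 'k \<Rightarrow> complex) star_alg" where
  "mat_alg K =
     \<lparr>carrier = {m. \<forall>i j. m i j \<noteq> 0 \<longrightarrow> i \<in> K \<and> j \<in> K},
      mult = (\<lambda>m n i j. \<Sum>k\<in>K. m i k * n k j),
      one = (\<lambda>i j. if i = j \<and> i \<in> K then 1 else 0),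
      zero = (\<lambda>i j. 0),
      add = (\<lambda>m n i j. m i j + n i j),
      smult = (\<lambda>c m i j. c * m i j),
      star = (\<lambda>m i j. cnj (m j i))\<rparr>"

lemma mat_alg_simps [simp]:
  "m \<in> carrier (mat_alg K) \<longleftrightarrow> (\<forall>i j. m i j \<noteq> 0 \<longrightarrow> i \<in> K \<and> j \<in> K)"
  "mult (mat_alg K) m n = (\<lambda>i j. \<Sum>k\<in>K. m i k * n k j)"
  "one (mat_alg K) = (\<lambda>i j. if i = j \<and> i \<in> K then 1 else 0)"
  "add (mat_alg K) m n = (\<lambda>i j. m i j + n i j)"
  "smult (mat_alg K) c m = (\<lambda>i j. c * m i j)"
  "star (mat_alg K) m = (\<lambda>i j. cnj (m j i))"
  by (simp_all add: mat_alg_def)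

lift_definition scaleC_l2 :: "complex \<Rightarrow> 'k l2 \<Rightarrow> 'k l2" is "\<lambda>c f k. c * f k"
  by (rule square_summable_cmult)

lemma l2_nth_scaleC [simp]: "l2_nth (scaleC_l2 c x) k = c * l2_nth x k"
  by transfer simp

lemma norm_scaleC_l2: "norm (scaleC_l2 c x) = cmod c * norm x"
proof -
  have "(norm (scaleC_l2 c x))\<^sup>2 = (cmod c * norm x)\<^sup>2"
    by (simp add: l2_norm_square norm_mult power_mult_distrib infsum_cmult_right')
  then show ?thesis
    by (simp add: power2_eq_iff_nonneg)
qed

lemma bounded_linear_scaleC_l2: "bounded_linear (scaleC_l2 c)"
  by (rule bounded_linear_intro[of _ "cmod c"])
    (auto intro!: l2_eqI simp: norm_scaleC_l2 algebra_simps)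

lemma compose_assoc: "(X o\<^sub>L Y) o\<^sub>L Z = X o\<^sub>L (Y o\<^sub>L Z)"
  by (rule blinfun_eqI) simp

lemma compose_id: "X o\<^sub>L id_blinfun = X" "id_blinfun o\<^sub>L X = X"
  by (rule blinfun_eqI, simp)+

definition scalar_op :: "complex \<Rightarrow> 'k l2 \<Rightarrow>\<^sub>L 'k l2" where
  "scalar_op c = Blinfun (scaleC_l2 c)"

lemma scalar_op_apply [simp]: "blinfun_apply (scalar_op c) = scaleC_l2 c"
  by (simp add: scalar_op_def bounded_linear_Blinfun_apply bounded_linear_scaleC_l2)

lemma scalar_op_one: "scalar_op 1 = id_blinfun"
  by (intro blinfun_eqI l2_eqI) simp

lemma scalar_op_mult: "scalar_op (c * d) = scalar_op c o\<^sub>L scalar_op d"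
  by (intro blinfun_eqI l2_eqI) (simp add: mult.assoc)

lemma scalar_op_add: "scalar_op (c + d) = scalar_op c + scalar_op d"
  by (intro blinfun_eqI l2_eqI) (simp add: blinfun.bilinear_simps algebra_simps)

lemma norm_scalar_op_compose: "norm (scalar_op c o\<^sub>L X) = cmod c * norm X"
proof -
  have le: "norm (scalar_op c o\<^sub>L X) \<le> cmod c * norm X" for c and X :: "'a \<Rightarrow>\<^sub>L 'k l2"
  proof (rule norm_blinfun_bound)
    show "norm ((scalar_op c o\<^sub>L X) x) \<le> cmod c * norm X * norm x" for x
      using mult_left_mono[OF norm_blinfun[of X x], of "cmod c"]
      by (simp add: norm_scaleC_l2 mult.assoc)
  qed simp
  show ?thesis
  proof (cases "c = 0")
    case False
    \<comment> \<open>The bound \<open>le\<close>, applied to \<open>inverse c\<close>, yields the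
      reverse inequality.\<close>
    have "X = scalar_op (inverse c) o\<^sub>L (scalar_op c o\<^sub>L X)"
      using False by (intro blinfun_eqI l2_eqI) simp
    then have "norm X \<le> cmod (inverse c) * norm (scalar_op c o\<^sub>L X)"
      using le[of "inverse c" "scalar_op c o\<^sub>L X"] by simp
    from mult_left_mono[OF this, of "cmod c"]
    have "cmod c * norm X \<le> norm (scalar_op c o\<^sub>L X)"
      using False
      by (simp add: norm_inverse flip: mult.assoc)
    then show ?thesis
      using le[of c X] by simp
  qed (use le[of 0 X] in simp)
qed

text \<open>A relation requires no existence theorem: adjoints of scalars and shifts are exhibited,
  and the relation is carried through sums, compositions and limits. For complex-linear
  \<open>X\<close>, replacing \<open>x\<close> by its multiple by the imaginary unit recovers the
  imaginary part of the Hermitian identity.\<close>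

definition adjoint_pair :: "('h::real_inner \<Rightarrow>\<^sub>L 'h) \<Rightarrow> ('h \<Rightarrow>\<^sub>L 'h) \<Rightarrow> bool" where
  "adjoint_pair X Y \<longleftrightarrow> (\<forall>x y. inner (X x) y = inner x (Y y))"

lemma adjoint_pair_sym: "adjoint_pair X Y \<Longrightarrow> adjoint_pair Y X"
  unfolding adjoint_pair_def by (metis inner_commute)

lemma adjoint_pair_unique:
  assumes "adjoint_pair X Y" "adjoint_pair X Z"
  shows "Y = Z"
proof (rule blinfun_eqI)
  fix y
  have "inner x (Y y - Z y) = 0" for x
    using assms by (simp add: adjoint_pair_def inner_diff_right)
  then show "Y y = Z y"
    by (metis inner_eq_zero_iff right_minus_eq)
qed

lemma adjoint_pair_add: "adjoint_pair X Y \<Longrightarrow> adjoint_pair X' Y' \<Longrightarrow> adjoint_pair (X + X') (Y + Y')"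
  by (simp add: adjoint_pair_def blinfun.bilinear_simps inner_add_left inner_add_right)

lemma adjoint_pair_diff: "adjoint_pair X Y \<Longrightarrow> adjoint_pair X' Y' \<Longrightarrow> adjoint_pair (X - X') (Y - Y')"
  by (simp add: adjoint_pair_def blinfun.bilinear_simps inner_diff_left inner_diff_right)

lemma adjoint_pair_sum:
  "(\<And>i. i \<in> S \<Longrightarrow> adjoint_pair (f i) (g i)) \<Longrightarrow> adjoint_pair (\<Sum>i\<in>S. f i) (\<Sum>i\<in>S. g i)"
  by (induction S rule: infinite_finite_induct) (auto simp: adjoint_pair_add, auto simp: adjoint_pair_def)

lemma adjoint_pair_compose:
  "adjoint_pair X Y \<Longrightarrow> adjoint_pair X' Y' \<Longrightarrow> adjoint_pair (X o\<^sub>L X') (Y' o\<^sub>L Y)"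
  by (simp add: adjoint_pair_def)

lemma adjoint_pair_scalar: "adjoint_pair (scalar_op c) (scalar_op (cnj c))"
  by (simp add: adjoint_pair_def inner_l2_def inner_complex_def algebra_simps)

text \<open>By Cauchy-Schwarz applied to \<open>inner x (Y (X x))\<close>, the square of
  \<open>norm X\<close> is at most the norm of the composition. The reverse estimate needs
  \<open>norm Y \<le> norm X\<close>, which is the same inequality with the roles exchanged, after
  cancelling \<open>norm Y\<close>. This becomes the C*-identity.\<close>

lemma adjoint_pair_norm_square:
  assumes "adjoint_pair X Y"
  shows "norm (Y o\<^sub>L X) = (norm X)\<^sup>2"
proof -
  have sq: "(norm X)\<^sup>2 \<le> norm (Y o\<^sub>L X)" if "adjoint_pair X Y" for X Y :: "'a \<Rightarrow>\<^sub>L 'a"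
  proof -
    have "norm X \<le> sqrt (norm (Y o\<^sub>L X))"
    proof (rule norm_blinfun_bound)
      fix x
      have "(norm (X x))\<^sup>2 = inner x ((Y o\<^sub>L X) x)"
        using that by (simp add: adjoint_pair_def power2_norm_eq_inner)
      also have "\<dots> \<le> norm x * norm ((Y o\<^sub>L X) x)"
        by (rule norm_cauchy_schwarz)
      also have "\<dots> \<le> norm x * (norm (Y o\<^sub>L X) * norm x)"
        by (intro mult_left_mono norm_blinfun) auto
      also have "\<dots> = (sqrt (norm (Y o\<^sub>L X)) * norm x)\<^sup>2"
        by (simp add: power_mult_distrib power2_eq_square)
      finally show "norm (X x) \<le> sqrt (norm (Y o\<^sub>L X)) * norm x"
        by (rule power2_le_imp_le) simp
    qed simp
    then show ?thesis
      by (metis norm_ge_zero power_mono real_sqrt_pow2)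
  qed
  have prod: "norm (Y o\<^sub>L X) \<le> norm Y * norm X"
    by (rule norm_blinfun_compose)
  have "norm X * norm X \<le> norm Y * norm X"
    using sq[OF assms] prod by (simp add: power2_eq_square)
  have "(norm Y)\<^sup>2 \<le> norm X * norm Y"
    using sq[OF adjoint_pair_sym[OF assms]] norm_blinfun_compose[of X Y] by simp
  then have "norm Y \<le> norm X"
    by (cases "norm Y = 0") (auto simp: power2_eq_square mult_le_cancel_right)
  then have "norm Y * norm X \<le> (norm X)\<^sup>2"
    by (simp add: power2_eq_square mult_right_mono)
  then show ?thesis
    using sq[OF assms] prod by linarith
qed

lemma adjoint_pair_norm:
  assumes "adjoint_pair X Y"
  shows "norm Y = norm X"
proof -
  have "norm X \<le> norm Y" if "adjoint_pair X Y" for X Y :: "'a \<Rightarrow>\<^sub>L 'a"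
    using adjoint_pair_norm_square[OF that] norm_blinfun_compose[of Y X]
    by (cases "norm X = 0") (auto simp: power2_eq_square mult_le_cancel_right)
  from this[OF assms] this[OF adjoint_pair_sym[OF assms]] show ?thesis
    by simp
qed

text \<open>Adjoints have the same norm, so adjoints of a convergent sequence converge.\<close>

lemma adjoint_pair_limit:
  fixes X :: "nat \<Rightarrow> 'h::{real_inner, banach} \<Rightarrow>\<^sub>L 'h"
  assumes "X \<longlonglongrightarrow> X0" "\<And>n. adjoint_pair (X n) (Y n)"
  obtains Y0 where "Y \<longlonglongrightarrow> Y0" "adjoint_pair X0 Y0"
proof -
  have "dist (Y m) (Y n) = dist (X m) (X n)" for m n
    by (simp add: dist_norm adjoint_pair_norm adjoint_pair_diff assms)
  then have "Cauchy Y"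
    using LIMSEQ_imp_Cauchy[OF assms(1)] by (simp add: Cauchy_def)
  then obtain Y0 where Y0: "Y \<longlonglongrightarrow> Y0"
    using Cauchy_convergent_iff convergent_def by blast
  have "inner (X0 x) y = inner x (Y0 y)" for x y
  proof (rule LIMSEQ_unique)
    show "(\<lambda>n. inner (X n x) y) \<longlonglongrightarrow> inner (X0 x) y"
      by (intro tendsto_intros assms)
    have "(\<lambda>n. inner x (Y n y)) \<longlonglongrightarrow> inner x (Y0 y)"
      by (intro tendsto_intros Y0)
    then show "(\<lambda>n. inner (X n x) y) \<longlonglongrightarrow> inner x (Y0 y)"
      using assms(2) by (simp add: adjoint_pair_def)
  qed
  with Y0 that show ?thesis
    by (simp add: adjoint_pair_def)
qed

text \<open>Pulling back along a map that is not injective can repeat a value infinitely often and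
  leave the space. The test \<open>inj_on p P\<close>, with default value 0, makes the lifting
  total; it holds for all the shifts that occur in \<open>loc_op\<close>.\<close>

lift_definition shift_l2 :: "'k set \<Rightarrow> ('k \<Rightarrow> 'k) \<Rightarrow> 'k l2 \<Rightarrow> 'k l2"
  is "\<lambda>P p f k. if k \<in> P \<and> inj_on p P then f (p k) else 0"
proof -
  fix P :: "'k set" and p and f :: "'k \<Rightarrow> complex"
  assume f: "(\<lambda>k. (cmod (f k))\<^sup>2) summable_on UNIV"
  show "(\<lambda>k. (cmod (if k \<in> P \<and> inj_on p P then f (p k) else 0))\<^sup>2) summable_on UNIV"
  proof (cases "inj_on p P")
    case True
    have "(\<lambda>k. (cmod (f k))\<^sup>2) summable_on p ` P"
      by (rule summable_on_subset[OF f]) simp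
    then have "(\<lambda>k. (cmod (f (p k)))\<^sup>2) summable_on P"
      using summable_on_reindex[OF True, of "\<lambda>k. (cmod (f k))\<^sup>2"] by (simp add: o_def)
    then show ?thesis
      by (rule summable_on_cong_neutral[THEN iffD1, rotated -1]) (use True in auto)
  qed simp
qed

lemma l2_nth_shift:
  "inj_on p P \<Longrightarrow> l2_nth (shift_l2 P p x) k = (if k \<in> P then l2_nth x (p k) else 0)"
  by transfer simp

lemma norm_shift_le:
  assumes "inj_on p P"
  shows "norm (shift_l2 P p x) \<le> norm x"
proof (rule l2_norm_le)
  fix F :: "'a set" assume "finite F"
  have "(\<Sum>k\<in>F. (cmod (l2_nth (shift_l2 P p x) k))\<^sup>2) = (\<Sum>k\<in>F \<inter> P. (cmod (l2_nth x (p k)))\<^sup>2)"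
    using \<open>finite F\<close> assms by (intro sum.mono_neutral_cong_right) (auto simp: l2_nth_shift)
  also have "\<dots> = (\<Sum>k\<in>p ` (F \<inter> P). (cmod (l2_nth x k))\<^sup>2)"
    by (subst sum.reindex) (auto intro: inj_on_subset[OF assms])
  also have "\<dots> \<le> (norm x)\<^sup>2"
    using \<open>finite F\<close> by (intro l2_sum_le) auto
  finally show "(\<Sum>k\<in>F. (cmod (l2_nth (shift_l2 P p x) k))\<^sup>2) \<le> (norm x)\<^sup>2" .
qed simp

definition shift_op :: "'k set \<Rightarrow> ('k \<Rightarrow> 'k) \<Rightarrow> 'k l2 \<Rightarrow>\<^sub>L 'k l2" where
  "shift_op P p = Blinfun (shift_l2 P p)"

lemma shift_op_apply:
  assumes "inj_on p P"
  shows "blinfun_apply (shift_op P p) = shift_l2 P p"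
proof -
  have "bounded_linear (shift_l2 P p)"
    by (rule bounded_linear_intro[of _ 1])
      (auto intro!: l2_eqI simp: l2_nth_shift assms norm_shift_le)
  then show ?thesis
    by (simp add: shift_op_def bounded_linear_Blinfun_apply)
qed

text \<open>The substitution of \<open>p k\<close> for \<open>k\<close> in the sum. The shift is a
  partial isometry, and its adjoint pulls back along the inverse \<open>q\<close> of
  \<open>p\<close>.\<close>

lemma adjoint_pair_shift:
  assumes "bij_betw p P Q" "\<And>k. k \<in> P \<Longrightarrow> q (p k) = k"
  shows "adjoint_pair (shift_op P p) (shift_op Q q)"
proof -
  have p: "inj_on p P"
    using assms bij_betw_def by blast
  have q: "inj_on q Q"
    using assms unfolding bij_betw_def inj_on_def by force
  have "inner (shift_l2 P p x) y = inner x (shift_l2 Q q y)" for x y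
  proof -
    have "inner (shift_l2 P p x) y = (\<Sum>\<^sub>\<infinity>k\<in>P. inner (l2_nth x (p k)) (l2_nth y (q (p k))))"
      unfolding inner_l2_def
      by (intro infsum_cong_neutral) (auto simp: l2_nth_shift p assms)
    also have "\<dots> = (\<Sum>\<^sub>\<infinity>k\<in>Q. inner (l2_nth x k) (l2_nth y (q k)))"
      by (rule infsum_reindex_bij_betw[OF assms(1)])
    also have "\<dots> = inner x (shift_l2 Q q y)"
      unfolding inner_l2_def
      by (intro infsum_cong_neutral) (auto simp: l2_nth_shift q)
    finally show ?thesis .
  qed
  then show ?thesis
    by (simp add: adjoint_pair_def shift_op_apply p q)
qed

section \<open>Local operators\<close>

abbreviation conf :: "'i set \<Rightarrow> ('i \<Rightarrow> 's) set" where
  "conf L \<equiv> \<Pi>\<^sub>E i\<in>L. UNIV"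

lemma override_on_conf [simp]:
  "u \<in> conf L \<Longrightarrow> restrict (override_on s u L) L = u"
  by (auto simp: fun_eq_iff override_on_def PiE_iff extensional_def)

lemma override_on_restrict [simp]: "override_on s (restrict s L) L = s"
  by (auto simp: fun_eq_iff override_on_def)

lemma override_on_override_on [simp]: "override_on (override_on s u L) v L = override_on s v L"
  by (auto simp: fun_eq_iff override_on_def)

lemma finite_conf [simp]: "finite L \<Longrightarrow> finite (conf L :: ('i \<Rightarrow> 's::finite) set)"
  by (rule finite_PiE) auto

text \<open>Each shift is a matrix unit in the representation: it reads the vector at
  \<open>u\<close> on \<open>L\<close>, writes at \<open>v\<close>, and keeps all other sites. As a
  finite combination of bounded operators the sum is bounded by construction, and its adjoint can be
  taken term by term; \<open>l2_nth_loc_op\<close> gives the action in coordinates.\<close>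

definition loc_op ::
  "'i set \<Rightarrow> (('i \<Rightarrow> 's::finite) \<Rightarrow> ('i \<Rightarrow> 's) \<Rightarrow> complex) \<Rightarrow> ('i \<Rightarrow> 's) l2 \<Rightarrow>\<^sub>L ('i \<Rightarrow> 's) l2" where
  "loc_op L m = (\<Sum>v\<in>conf L. \<Sum>u\<in>conf L.
     scalar_op (m v u) o\<^sub>L shift_op {s. restrict s L = v} (\<lambda>s. override_on s u L))"

lemma bij_betw_override_on:
  assumes "v \<in> conf L" "u \<in> conf L"
  shows "bij_betw (\<lambda>s. override_on s u L) {s. restrict s L = v} {s. restrict s L = u}"
  by (rule bij_betw_byWitness[where f' = "\<lambda>s. override_on s v L"]) (use assms in auto)

lemma l2_nth_sum: "l2_nth (\<Sum>i\<in>S. f i) k = (\<Sum>i\<in>S. l2_nth (f i) k)"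
  by (induction S rule: infinite_finite_induct) auto

lemma l2_nth_loc_op:
  assumes "finite L"
  shows "l2_nth (loc_op L m x) s = (\<Sum>u\<in>conf L. m (restrict s L) u * l2_nth x (override_on s u L))"
proof -
  have "l2_nth (loc_op L m x) s = (\<Sum>v\<in>conf L. \<Sum>u\<in>conf L.
      if restrict s L = v then m v u * l2_nth x (override_on s u L) else 0)"
    unfolding loc_op_def blinfun.sum_left l2_nth_sum
  proof (intro sum.cong refl)
    fix v u :: "'a \<Rightarrow> 'b" assume "v \<in> conf L" "u \<in> conf L"
    then have "inj_on (\<lambda>s. override_on s u L) {s. restrict s L = v}"
      by (rule bij_betw_imp_inj_on[OF bij_betw_override_on])
    then show "l2_nth ((scalar_op (m v u) o\<^sub>L shift_op {s. restrict s L = v} (\<lambda>s. override_on s u L)) x) s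
        = (if restrict s L = v then m v u * l2_nth x (override_on s u L) else 0)"
      by (simp add: shift_op_apply l2_nth_shift)
  qed
  also have "\<dots> = (\<Sum>v\<in>conf L. if v = restrict s L
      then \<Sum>u\<in>conf L. m v u * l2_nth x (override_on s u L) else 0)"
    by (intro sum.cong) auto
  also have "\<dots> = (\<Sum>u\<in>conf L. m (restrict s L) u * l2_nth x (override_on s u L))"
    using assms by (simp add: sum.delta)
  finally show ?thesis .
qed

lemma loc_op_add:
  "finite L \<Longrightarrow> loc_op L (m \<oplus>\<^bsub>mat_alg (conf L)\<^esub> n) = loc_op L m + loc_op L n"
  by (intro blinfun_eqI l2_eqI)
    (simp add: l2_nth_loc_op blinfun.bilinear_simps algebra_simps sum.distrib)

lemma loc_op_smult:
  "finite L \<Longrightarrow> loc_op L (c \<odot>\<^bsub>mat_alg (conf L)\<^esub> m) = scalar_op c o\<^sub>L loc_op L m"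
  by (intro blinfun_eqI l2_eqI) (simp add: l2_nth_loc_op sum_distrib_left mult.assoc)

text \<open>This is complex linearity of local operators. It is what later brings the adjoint of a
  scalar multiple into the right order.\<close>

lemma loc_op_scalar_commute:
  "finite L \<Longrightarrow> loc_op L m o\<^sub>L scalar_op c = scalar_op c o\<^sub>L loc_op L m"
  by (intro blinfun_eqI l2_eqI) (simp add: l2_nth_loc_op sum_distrib_left mult_ac)

lemma loc_op_mult:
  assumes "finite L"
  shows "loc_op L (m \<otimes>\<^bsub>mat_alg (conf L)\<^esub> n) = loc_op L m o\<^sub>L loc_op L n"
proof (intro blinfun_eqI l2_eqI)
  fix x s
  have "l2_nth ((loc_op L m o\<^sub>L loc_op L n) x) s
      = (\<Sum>u\<in>conf L. \<Sum>w\<in>conf L. m (restrict s L) u * n u w * l2_nth x (override_on s w L))"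
    using assms by (simp add: l2_nth_loc_op sum_distrib_left mult.assoc)
  also have "\<dots> = (\<Sum>w\<in>conf L. \<Sum>u\<in>conf L. m (restrict s L) u * n u w * l2_nth x (override_on s w L))"
    by (rule sum.swap)
  finally show "l2_nth (loc_op L (m \<otimes>\<^bsub>mat_alg (conf L)\<^esub> n) x) s
      = l2_nth ((loc_op L m o\<^sub>L loc_op L n) x) s"
    using assms by (simp add: l2_nth_loc_op sum_distrib_right)
qed

lemma loc_op_one:
  assumes "finite L"
  shows "loc_op L \<one>\<^bsub>mat_alg (conf L)\<^esub> = id_blinfun"
proof (intro blinfun_eqI l2_eqI)
  fix x s
  have "l2_nth (loc_op L \<one>\<^bsub>mat_alg (conf L)\<^esub> x) s
      = (\<Sum>u\<in>conf L. if u = restrict s L then l2_nth x (override_on s u L) else 0)"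
    unfolding l2_nth_loc_op[OF assms] by (intro sum.cong) auto
  also have "\<dots> = l2_nth x s"
    using assms by (simp add: sum.delta)
  finally show "l2_nth (loc_op L \<one>\<^bsub>mat_alg (conf L)\<^esub> x) s = l2_nth (id_blinfun x) s"
    by simp
qed

text \<open>The shifts from \<open>v\<close> to \<open>u\<close> and from \<open>u\<close> to
  \<open>v\<close> are adjoint, so exchanging the two sums transposes the matrix, and the adjoints
  of the scalars conjugate its entries.\<close>

lemma adjoint_pair_loc_op: "adjoint_pair (loc_op L m) (loc_op L (star (mat_alg (conf L)) m))"
proof -
  have "adjoint_pair (loc_op L m) (\<Sum>v\<in>conf L. \<Sum>u\<in>conf L.
     shift_op {s. restrict s L = u} (\<lambda>s. override_on s v L) o\<^sub>L scalar_op (cnj (m v u)))"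
    unfolding loc_op_def
    by (intro adjoint_pair_sum adjoint_pair_compose adjoint_pair_scalar adjoint_pair_shift
        bij_betw_override_on) auto
  also have "(\<Sum>v\<in>conf L. \<Sum>u\<in>conf L.
     shift_op {s. restrict s L = u} (\<lambda>s. override_on s v L) o\<^sub>L scalar_op (cnj (m v u)))
     = loc_op L (star (mat_alg (conf L)) m)"
    unfolding loc_op_def
  proof (subst sum.swap, intro sum.cong refl)
    fix v u :: "'a \<Rightarrow> 'b" assume "v \<in> conf L" "u \<in> conf L"
    then have "inj_on (\<lambda>s. override_on s u L) {s. restrict s L = v}"
      by (rule bij_betw_imp_inj_on[OF bij_betw_override_on])
    then show "shift_op {s. restrict s L = v} (\<lambda>s. override_on s u L) o\<^sub>L scalar_op (cnj (m u v))
        = scalar_op (star (mat_alg (conf L)) m v u) o\<^sub>L shift_op {s. restrict s L = v} (\<lambda>s. override_on s u L)"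
      by (intro blinfun_eqI l2_eqI) (simp add: shift_op_apply l2_nth_shift)
  qed
  finally show ?thesis .
qed

section \<open>Faithfulness and closed range of the local representation\<close>

lift_definition ket :: "'k \<Rightarrow> 'k l2" is "\<lambda>j k. if k = j then 1 else 0"
proof -
  fix j :: 'k
  have "(\<lambda>k. (cmod (if k = j then 1 else 0))\<^sup>2) summable_on {j}"
    by simp
  then show "(\<lambda>k. (cmod (if k = j then 1 else 0))\<^sup>2) summable_on UNIV"
    by (rule summable_on_cong_neutral[THEN iffD1, rotated -1]) auto
qed

lemma l2_nth_ket: "l2_nth (ket j) k = (if k = j then 1 else 0)"
  by transfer simp

text \<open>An element of \<open>conf L\<close> is also a configuration on all sites, with the value
  \<open>undefined\<close> off \<open>L\<close>. Two such elements agree off \<open>L\<close>, so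
  overriding \<open>v\<close> on \<open>L\<close> by \<open>w\<close> gives exactly
  \<open>w\<close>, and the basis vectors at these configurations read off the entries.\<close>

lemma loc_op_entry:
  assumes "finite L" "v \<in> conf L" "u \<in> conf L"
  shows "l2_nth (loc_op L m (ket u)) v = m v u"
proof -
  have "override_on v w L = w" if "w \<in> conf L" for w
    using that assms(2) by (auto simp: fun_eq_iff override_on_def PiE_iff extensional_def)
  moreover have "restrict v L = v"
    using assms(2) by (simp add: PiE_restrict)
  ultimately have "l2_nth (loc_op L m (ket u)) v = (\<Sum>w\<in>conf L. if w = u then m v w else 0)"
    unfolding l2_nth_loc_op[OF assms(1)] by (intro sum.cong) (auto simp: l2_nth_ket)
  then show ?thesis
    using assms by (simp add: sum.delta)
qed

lemma loc_op_inj: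
  assumes "finite L"
  shows "inj_on (loc_op L) (carrier (mat_alg (conf L)))"
proof (rule inj_onI)
  fix m n :: "('a \<Rightarrow> 'b) \<Rightarrow> ('a \<Rightarrow> 'b) \<Rightarrow> complex"
  assume mn: "m \<in> carrier (mat_alg (conf L))" "n \<in> carrier (mat_alg (conf L))"
    and "loc_op L m = loc_op L n"
  then have "m v u = n v u" if "v \<in> conf L" "u \<in> conf L" for v u
    using that loc_op_entry[OF assms, of v u] by metis
  moreover have "m v u = 0" "n v u = 0" if "\<not> (v \<in> conf L \<and> u \<in> conf L)" for v u
    using that mn unfolding mat_alg_simps by blast+
  ultimately show "m = n"
    by (intro ext) metis
qed

text \<open>The range of \<^const>\<open>loc_op\<close> is the set of fixed points of a continuous
  linear map, which reads off the matrix entries.\<close>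

lemma closed_loc_op_range:
  assumes "finite L"
  shows "closed (loc_op L ` carrier (mat_alg (conf L :: ('i \<Rightarrow> 's::finite) set)))"
proof -
  define entries where "entries X = (\<lambda>v u. of_bool (v \<in> conf L \<and> u \<in> conf L) * l2_nth (X (ket u)) v)"
    for X :: "('i \<Rightarrow> 's) l2 \<Rightarrow>\<^sub>L ('i \<Rightarrow> 's) l2"
  have "loc_op L ` carrier (mat_alg (conf L)) = {X. loc_op L (entries X) = X}"
  proof (intro equalityI subsetI)
    fix X assume "X \<in> loc_op L ` carrier (mat_alg (conf L :: ('i \<Rightarrow> 's) set))"
    then obtain m where m: "m \<in> carrier (mat_alg (conf L))" and X: "X = loc_op L m"
      by blast
    have "entries X v u = m v u" for v u
      using m assms by (auto simp: entries_def X loc_op_entry simp del: PiE_iff)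
    then have "entries X = m"
      by (intro ext)
    then show "X \<in> {X. loc_op L (entries X) = X}"
      by (simp add: X)
  next
    fix X assume "X \<in> {X. loc_op L (entries X) = X}"
    moreover have "entries X \<in> carrier (mat_alg (conf L))"
      by (auto simp: entries_def)
    ultimately show "X \<in> loc_op L ` carrier (mat_alg (conf L))"
      by force
  qed
  moreover have "closed {X. loc_op L (entries X) = X}"
  proof (rule closed_Collect_eq)
    have nth: "bounded_linear (\<lambda>x :: ('i \<Rightarrow> 's) l2. l2_nth x v)" for v
      by (rule bounded_linear_intro[of _ 1]) (auto simp: l2_nth_le_norm scaleR_conv_of_real)
    have scal: "bounded_linear (\<lambda>c. scalar_op c :: ('i \<Rightarrow> 's) l2 \<Rightarrow>\<^sub>L ('i \<Rightarrow> 's) l2)"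
    proof (rule bounded_linear_intro[of _ "norm (id_blinfun :: ('i \<Rightarrow> 's) l2 \<Rightarrow>\<^sub>L ('i \<Rightarrow> 's) l2)"])
      show "scalar_op (r *\<^sub>R c) = r *\<^sub>R (scalar_op c :: ('i \<Rightarrow> 's) l2 \<Rightarrow>\<^sub>L _)" for r c
        by (intro blinfun_eqI l2_eqI) (simp add: blinfun.bilinear_simps scaleR_conv_of_real)
      show "norm (scalar_op c :: ('i \<Rightarrow> 's) l2 \<Rightarrow>\<^sub>L _) \<le> norm c * norm (id_blinfun :: ('i \<Rightarrow> 's) l2 \<Rightarrow>\<^sub>L _)" for c
        using norm_scalar_op_compose[of c "id_blinfun :: ('i \<Rightarrow> 's) l2 \<Rightarrow>\<^sub>L _"]
        by (simp add: compose_id)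
    qed (simp add: scalar_op_add)
    have "continuous_on UNIV (\<lambda>X. entries X v u)" for v u
      unfolding entries_def
      by (intro continuous_intros linear_continuous_on[OF bounded_linear_compose[OF nth blinfun.bounded_linear_left]])
    then show "continuous_on UNIV (\<lambda>X. loc_op L (entries X))"
      unfolding loc_op_def
      by (intro continuous_on_sum bounded_bilinear.continuous_on[OF bounded_bilinear_blinfun_compose] bounded_linear.continuous_on[OF scal] continuous_on_const)
  qed (intro continuous_intros)
  ultimately show ?thesis
    by (rule ssubst)
qed

text \<open>The Kronecker product of \<open>m\<close> with the identity matrix on
  \<open>M - L\<close>; the identity factor is the agreement condition on the restrictions to
  \<open>M - L\<close>.\<close>

definition extend_mat ::
  "'i set \<Rightarrow> 'i set \<Rightarrow> (('i \<Rightarrow> 's) \<Rightarrow> ('i \<Rightarrow> 's) \<Rightarrow> complex) \<Rightarrow> ('i \<Rightarrow> 's) \<Rightarrow> ('i \<Rightarrow> 's) \<Rightarrow> complex" where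
  "extend_mat L M m = (\<lambda>s t. if s \<in> conf M \<and> t \<in> conf M \<and> restrict s (M - L) = restrict t (M - L)
     then m (restrict s L) (restrict t L) else 0)"

lemma extend_mat_self: "m \<in> carrier (mat_alg (conf L)) \<Longrightarrow> extend_mat L L m = m"
  by (auto simp: extend_mat_def fun_eq_iff PiE_restrict simp del: PiE_iff)

text \<open>Only those configurations on \<open>M\<close> contribute that agree with
  \<open>s\<close> off \<open>L\<close>. They correspond to their restrictions to \<open>L\<close>,
  and for them overriding \<open>s\<close> on \<open>M\<close> is the same as overriding it on
  \<open>L\<close>.\<close>

lemma loc_op_extend_mat:
  assumes "finite M" "L \<subseteq> M"
  shows "loc_op M (extend_mat L M m) = loc_op L m"
proof (intro blinfun_eqI l2_eqI)
  fix x s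
  have fin: "finite L"
    using assms finite_subset by blast
  let ?e = "extend_mat L M m (restrict s M)"
  let ?S = "{u \<in> conf M. restrict s (M - L) = restrict u (M - L)}"
  have [simp]: "M \<inter> L = L" "M \<inter> (M - L) = M - L" "L \<inter> M = L" "(M - L) \<inter> M = M - L"
    using assms by auto
  have "l2_nth (loc_op M (extend_mat L M m) x) s
      = (\<Sum>u\<in>?S. m (restrict s L) (restrict u L) * l2_nth x (override_on s u M))"
    unfolding l2_nth_loc_op[OF assms(1)]
    using assms by (intro sum.mono_neutral_cong_right) (auto simp: extend_mat_def)
  also have "\<dots> = (\<Sum>w\<in>conf L. m (restrict s L) w * l2_nth x (override_on s w L))"
  proof (rule sum.reindex_bij_witness[where i = "\<lambda>w. restrict (override_on s w L) M" and j = "\<lambda>u. restrict u L"])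
    fix u assume u: "u \<in> ?S"
    have *: "s i = u i" if "i \<in> M" "i \<notin> L" for i
      using u that by (auto dest: fun_cong[where x = i])
    show "restrict (override_on s (restrict u L) L) M = u"
      using u assms * by (auto simp: fun_eq_iff override_on_def PiE_iff extensional_def)
    have "override_on s (restrict u L) L = override_on s u M"
      using assms * by (auto simp: fun_eq_iff override_on_def)
    then show "m (restrict s L) (restrict u L) * l2_nth x (override_on s (restrict u L) L)
        = m (restrict s L) (restrict u L) * l2_nth x (override_on s u M)"
      by simp
  next
    fix w assume w: "w \<in> (conf L :: ('a \<Rightarrow> 'b) set)"
    then show "restrict (restrict (override_on s w L) M) L = w"
      by (simp add: restrict_restrict)
    show "restrict (override_on s w L) M \<in> ?S"
      by (auto simp: fun_eq_iff override_on_def)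
  qed auto
  also have "\<dots> = l2_nth (loc_op L m x) s"
    by (simp add: l2_nth_loc_op[OF fin])
  finally show "l2_nth (loc_op M (extend_mat L M m) x) s = l2_nth (loc_op L m x) s" .
qed

section \<open>Tensor products of matrix algebras\<close>

definition mat_unit :: "'k \<Rightarrow> 'k \<Rightarrow> 'k \<Rightarrow> 'k \<Rightarrow> complex" where
  "mat_unit i j = (\<lambda>k l. if k = i \<and> l = j then 1 else 0)"

lemma mat_alg_add_closed:
  assumes "m \<in> carrier (mat_alg K)" "n \<in> carrier (mat_alg K)"
  shows "(\<lambda>i j. m i j + n i j) \<in> carrier (mat_alg K)"
proof -
  have "i \<in> K \<and> j \<in> K" if "m i j + n i j \<noteq> 0" for i j
  proof -
    have "m i j \<noteq> 0 \<or> n i j \<noteq> 0"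
      using that by auto
    then show ?thesis
      using assms by auto
  qed
  then show ?thesis
    by simp
qed

lemma mat_alg_closed:
  "\<one>\<^bsub>mat_alg K\<^esub> \<in> carrier (mat_alg K)"
  "m \<in> carrier (mat_alg K) \<Longrightarrow> n \<in> carrier (mat_alg K) \<Longrightarrow> m \<oplus>\<^bsub>mat_alg K\<^esub> n \<in> carrier (mat_alg K)"
  "m \<in> carrier (mat_alg K) \<Longrightarrow> c \<odot>\<^bsub>mat_alg K\<^esub> m \<in> carrier (mat_alg K)"
  "m \<in> carrier (mat_alg K) \<Longrightarrow> star (mat_alg K) m \<in> carrier (mat_alg K)"
  by (simp, simp only: mat_alg_simps(4) mat_alg_add_closed, auto)

text \<open>Matrix units span, so a property compatible with linear combinations has to be checked
  only on them. The induction adds one entry of the matrix at a time.\<close>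

lemma mat_alg_induct [consumes 2, case_names zero unit add smult]:
  assumes K: "finite K" and m: "m \<in> carrier (mat_alg K)"
    and zero: "P (\<lambda>i j. 0)"
    and unit: "\<And>i j. i \<in> K \<Longrightarrow> j \<in> K \<Longrightarrow> P (mat_unit i j)"
    and add: "\<And>m n. m \<in> carrier (mat_alg K) \<Longrightarrow> n \<in> carrier (mat_alg K) \<Longrightarrow> P m \<Longrightarrow> P n
      \<Longrightarrow> P (\<lambda>i j. m i j + n i j)"
    and smult: "\<And>c m. m \<in> carrier (mat_alg K) \<Longrightarrow> P m \<Longrightarrow> P (\<lambda>i j. c * m i j)"
  shows "P m"
proof -
  have "P (\<lambda>i j. if (i, j) \<in> S then m i j else 0)" if "finite S" "S \<subseteq> K \<times> K" for S
    using that
  proof (induction S rule: finite_induct)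
    case (insert p S)
    obtain i j where p: "p = (i, j)" "i \<in> K" "j \<in> K"
      using insert.prems by auto
    have "(\<lambda>k l. if (k, l) \<in> insert p S then m k l else 0)
        = (\<lambda>k l. (if (k, l) \<in> S then m k l else 0) + m i j * mat_unit i j k l)"
      using insert.hyps by (auto simp: fun_eq_iff mat_unit_def p)
    moreover have "P (\<lambda>k l. (if (k, l) \<in> S then m k l else 0) + m i j * mat_unit i j k l)"
      using insert p by (intro add smult unit) (auto simp: mat_unit_def split: if_splits)
    ultimately show ?case
      by simp
  qed (simp add: zero)
  from this[of "K \<times> K"] have "P (\<lambda>i j. if (i, j) \<in> K \<times> K then m i j else 0)"
    using K by simp
  also have "(\<lambda>i j. if (i, j) \<in> K \<times> K then m i j else 0) = m"
    using m by (auto simp: fun_eq_iff)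
  finally show ?thesis .
qed

text \<open>This is the invariant that tensor products preserve. It demands closed operations and an
  isomorphism onto matrices, but no algebraic laws: identities in \<open>R\<close> are proved by
  applying the injective map \<open>\<eta>\<close> to both sides.\<close>

locale matrix_model =
  fixes R :: "('a, 'm) star_alg_scheme" (structure)
    and K :: "'k set"
    and \<eta> :: "'a \<Rightarrow> 'k \<Rightarrow> 'k \<Rightarrow> complex"
  assumes finite_index: "finite K"
    and one_closed: "\<one> \<in> carrier R"
    and add_closed: "x \<in> carrier R \<Longrightarrow> y \<in> carrier R \<Longrightarrow> x \<oplus> y \<in> carrier R"
    and mult_closed: "x \<in> carrier R \<Longrightarrow> y \<in> carrier R \<Longrightarrow> x \<otimes> y \<in> carrier R"
    and smult_closed: "x \<in> carrier R \<Longrightarrow> c \<odot> x \<in> carrier R"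
    and star_closed: "x \<in> carrier R \<Longrightarrow> star R x \<in> carrier R"
    and iso: "star_iso R (mat_alg K) \<eta>"
    and map_one: "\<eta> \<one> = \<one>\<^bsub>mat_alg K\<^esub>"
begin

lemma map_closed: "x \<in> carrier R \<Longrightarrow> \<eta> x \<in> carrier (mat_alg K)"
  using iso unfolding star_iso_def star_hom_def by blast

lemma map_add: "x \<in> carrier R \<Longrightarrow> y \<in> carrier R \<Longrightarrow> \<eta> (x \<oplus> y) = \<eta> x \<oplus>\<^bsub>mat_alg K\<^esub> \<eta> y"
  and map_mult: "x \<in> carrier R \<Longrightarrow> y \<in> carrier R \<Longrightarrow> \<eta> (x \<otimes> y) = \<eta> x \<otimes>\<^bsub>mat_alg K\<^esub> \<eta> y"
  and map_smult: "x \<in> carrier R \<Longrightarrow> \<eta> (c \<odot> x) = c \<odot>\<^bsub>mat_alg K\<^esub> \<eta> x"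
  and map_star: "x \<in> carrier R \<Longrightarrow> \<eta> (star R x) = star (mat_alg K) (\<eta> x)"
  using iso unfolding star_iso_def star_hom_def by blast+

lemma map_inj: "\<eta> x = \<eta> y \<Longrightarrow> x \<in> carrier R \<Longrightarrow> y \<in> carrier R \<Longrightarrow> x = y"
  using iso unfolding star_iso_def bij_betw_def inj_on_def by blast

definition elt :: "('k \<Rightarrow> 'k \<Rightarrow> complex) \<Rightarrow> 'a" where
  "elt = inv_into (carrier R) \<eta>"

lemma elt_closed: "m \<in> carrier (mat_alg K) \<Longrightarrow> elt m \<in> carrier R"
  and map_elt: "m \<in> carrier (mat_alg K) \<Longrightarrow> \<eta> (elt m) = m"
  using iso unfolding star_iso_def bij_betw_def elt_def
  by (metis inv_into_into, metis f_inv_into_f)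

lemma elt_map: "x \<in> carrier R \<Longrightarrow> elt (\<eta> x) = x"
  by (rule map_inj) (simp_all add: map_elt elt_closed map_closed del: mat_alg_simps)

lemma elt_add:
  assumes "m \<in> carrier (mat_alg K)" "n \<in> carrier (mat_alg K)"
  shows "elt (\<lambda>i j. m i j + n i j) = elt m \<oplus> elt n"
proof (rule map_inj)
  have mn: "(\<lambda>i j. m i j + n i j) \<in> carrier (mat_alg K)"
    using assms by (rule mat_alg_add_closed)
  show "\<eta> (elt (\<lambda>i j. m i j + n i j)) = \<eta> (elt m \<oplus> elt n)"
    unfolding map_elt[OF mn] using assms by (simp add: map_add elt_closed map_elt del: mat_alg_simps(1))
  show "elt (\<lambda>i j. m i j + n i j) \<in> carrier R"
    by (rule elt_closed[OF mn])
qed (intro add_closed elt_closed assms)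

lemma elt_smult:
  assumes "m \<in> carrier (mat_alg K)"
  shows "elt (\<lambda>i j. c * m i j) = c \<odot> elt m"
proof (rule map_inj)
  have cm: "(\<lambda>i j. c * m i j) \<in> carrier (mat_alg K)"
    using assms by auto
  show "\<eta> (elt (\<lambda>i j. c * m i j)) = \<eta> (c \<odot> elt m)"
    unfolding map_elt[OF cm] using assms by (simp add: map_smult elt_closed map_elt del: mat_alg_simps(1))
  show "elt (\<lambda>i j. c * m i j) \<in> carrier R"
    by (rule elt_closed[OF cm])
qed (intro smult_closed elt_closed assms)

end

section \<open>Formal sums of tuples and the kernel of their evaluation as matrices\<close>

definition kron ::
  "'i set \<Rightarrow> ('i \<Rightarrow> 'k set) \<Rightarrow> ('i \<Rightarrow> 'a \<Rightarrow> 'k \<Rightarrow> 'k \<Rightarrow> complex) \<Rightarrow> ('i \<Rightarrow> 'a)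
    \<Rightarrow> ('i \<Rightarrow> 'k) \<Rightarrow> ('i \<Rightarrow> 'k) \<Rightarrow> complex" where
  "kron I K \<eta> a = (\<lambda>s t. if s \<in> Pi\<^sub>E I K \<and> t \<in> Pi\<^sub>E I K then \<Prod>i\<in>I. \<eta> i (a i) (s i) (t i) else 0)"

definition formal_mat ::
  "'i set \<Rightarrow> ('i \<Rightarrow> 'k set) \<Rightarrow> ('i \<Rightarrow> 'a \<Rightarrow> 'k \<Rightarrow> 'k \<Rightarrow> complex) \<Rightarrow> ('i, 'a) formal
    \<Rightarrow> ('i \<Rightarrow> 'k) \<Rightarrow> ('i \<Rightarrow> 'k) \<Rightarrow> complex" where
  "formal_mat I K \<eta> f = (\<lambda>s t. \<Sum>a | f a \<noteq> 0. f a * kron I K \<eta> a s t)"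

text \<open>The choice of a representative does not matter, since a coset of the relations is
  exactly one fibre of \<open>formal_mat\<close>; this is shown in
  \<open>coset_eq_fibre\<close>.\<close>

definition tensor_mat ::
  "'i set \<Rightarrow> ('i \<Rightarrow> 'k set) \<Rightarrow> ('i \<Rightarrow> 'a \<Rightarrow> 'k \<Rightarrow> 'k \<Rightarrow> complex) \<Rightarrow> ('i, 'a) tensor
    \<Rightarrow> ('i \<Rightarrow> 'k) \<Rightarrow> ('i \<Rightarrow> 'k) \<Rightarrow> complex" where
  "tensor_mat I K \<eta> X = formal_mat I K \<eta> (SOME f. f \<in> X)"

text \<open>The index sets \<open>K i\<close> may differ from factor to factor: sites all have the
  same matrix size, whereas two regions \<open>L\<close> and \<open>M - L\<close> in general do
  not.\<close>

locale tensor_model =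
  fixes I :: "'i set" and A :: "'i \<Rightarrow> ('a, 'm) star_alg_scheme" and K :: "'i \<Rightarrow> 'k set"
    and \<eta> :: "'i \<Rightarrow> 'a \<Rightarrow> 'k \<Rightarrow> 'k \<Rightarrow> complex"
  assumes finite_sites: "finite I"
    and model: "i \<in> I \<Longrightarrow> matrix_model (A i) (K i) (\<eta> i)"
begin

abbreviation "F \<equiv> formal_sums I A"
abbreviation "N \<equiv> tensor_null I A"
abbreviation "T \<equiv> Pi\<^sub>E I K"
abbreviation "kr \<equiv> kron I K \<eta>"
abbreviation "ev \<equiv> formal_mat I K \<eta>"

lemma finite_T: "finite T"
  by (intro finite_PiE finite_sites matrix_model.finite_index[OF model])

lemma kron_closed: "kr a \<in> carrier (mat_alg T)"
  by (simp add: kron_def)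

lemma F_carrier: "f \<in> carrier F \<longleftrightarrow> finite {a. f a \<noteq> 0} \<and> {a. f a \<noteq> 0} \<subseteq> tuples I A"
  by (simp add: formal_sums_def)

text \<open>Summing over a common finite superset of the supports makes linearity immediate even
  when coefficients cancel.\<close>

lemma ev_superset:
  assumes "finite S" "{a. f a \<noteq> 0} \<subseteq> S"
  shows "ev f s t = (\<Sum>a\<in>S. f a * kr a s t)"
  unfolding formal_mat_def using assms by (intro sum.mono_neutral_left) auto

lemma F_add:
  assumes "f \<in> carrier F" "g \<in> carrier F"
  shows "(\<lambda>a. f a + g a) \<in> carrier F"
proof -
  have "{a. f a + g a \<noteq> 0} \<subseteq> {a. f a \<noteq> 0} \<union> {a. g a \<noteq> 0}"
    by auto
  moreover have "finite ({a. f a \<noteq> 0} \<union> {a. g a \<noteq> 0})" "{a. f a \<noteq> 0} \<union> {a. g a \<noteq> 0} \<subseteq> tuples I A"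
    using assms by (simp_all add: F_carrier)
  ultimately show ?thesis
    unfolding F_carrier by (meson finite_subset order_trans)
qed

lemma F_scale: "f \<in> carrier F \<Longrightarrow> (\<lambda>a. c * f a) \<in> carrier F"
  unfolding F_carrier by (auto intro: finite_subset[of _ "{a. f a \<noteq> 0}"])

lemma F_diff: "f \<in> carrier F \<Longrightarrow> g \<in> carrier F \<Longrightarrow> (\<lambda>a. f a - g a) \<in> carrier F"
  using F_add[of f "\<lambda>a. -1 * g a"] F_scale[of g "-1"] by simp

lemma F_zero: "(\<lambda>a. 0) \<in> carrier F"
  by (simp add: F_carrier)

lemma F_delta: "a \<in> tuples I A \<Longrightarrow> delta a \<in> carrier F"
  by (auto simp: F_carrier delta_def)

lemma F_induct [consumes 1, case_names zero add]:
  assumes f: "f \<in> carrier F" and zero: "P (\<lambda>a. 0)"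
    and add: "\<And>g c a. g \<in> carrier F \<Longrightarrow> a \<in> tuples I A \<Longrightarrow> P g \<Longrightarrow> P (\<lambda>b. g b + c * delta a b)"
  shows "P f"
proof -
  have "P (\<lambda>b. if b \<in> S then f b else 0)" if "finite S" "S \<subseteq> tuples I A" for S
    using that
  proof (induction S rule: finite_induct)
    case (insert a S)
    have "(\<lambda>b. if b \<in> insert a S then f b else 0) = (\<lambda>b. (if b \<in> S then f b else 0) + f a * delta a b)"
      using insert.hyps by (intro ext) (auto simp: delta_def)
    moreover have "(\<lambda>b. if b \<in> S then f b else 0) \<in> carrier F"
      using insert by (auto simp: F_carrier)
    ultimately show ?case
      using insert by (simp add: add)
  qed (simp add: zero)
  from this[of "{a. f a \<noteq> 0}"] f have "P (\<lambda>b. if b \<in> {a. f a \<noteq> 0} then f b else 0)"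
    by (simp add: F_carrier)
  also have "(\<lambda>b. if b \<in> {a. f a \<noteq> 0} then f b else 0) = f"
    by auto
  finally show ?thesis .
qed

lemma ev_add:
  assumes "f \<in> carrier F" "g \<in> carrier F"
  shows "ev (\<lambda>a. f a + g a) = (\<lambda>s t. ev f s t + ev g s t)"
proof (intro ext)
  fix s t
  let ?S = "{a. f a \<noteq> 0} \<union> {a. g a \<noteq> 0}"
  have "finite ?S"
    using assms by (simp add: F_carrier)
  moreover have "{a. f a + g a \<noteq> 0} \<subseteq> ?S"
    by auto
  ultimately show "ev (\<lambda>a. f a + g a) s t = ev f s t + ev g s t"
    by (simp add: ev_superset[of ?S] sum.distrib distrib_right)
qed

lemma ev_scale:
  assumes "f \<in> carrier F"
  shows "ev (\<lambda>a. c * f a) = (\<lambda>s t. c * ev f s t)"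
proof (intro ext)
  fix s t
  have "finite {a. f a \<noteq> 0}" "{a. c * f a \<noteq> 0} \<subseteq> {a. f a \<noteq> 0}"
    using assms by (auto simp: F_carrier)
  then show "ev (\<lambda>a. c * f a) s t = c * ev f s t"
    by (simp add: ev_superset[of "{a. f a \<noteq> 0}"] sum_distrib_left mult.assoc)
qed

lemma ev_diff:
  assumes "f \<in> carrier F" "g \<in> carrier F"
  shows "ev (\<lambda>a. f a - g a) = (\<lambda>s t. ev f s t - ev g s t)"
  using ev_add[OF assms(1) F_scale[OF assms(2), of "-1"]] ev_scale[OF assms(2), of "-1"] by simp

lemma ev_zero: "ev (\<lambda>a. 0) = (\<lambda>s t. 0)"
  by (simp add: formal_mat_def)

lemma ev_delta: "ev (delta a) = kr a"
  by (intro ext) (simp add: ev_superset[of "{a}"] delta_def)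

lemma ev_closed: "f \<in> carrier F \<Longrightarrow> ev f \<in> carrier (mat_alg T)"
  using kron_closed unfolding formal_mat_def mat_alg_simps(1) by (metis (mono_tags, lifting) mult_zero_right sum.neutral)

lemma tuple_upd: "a \<in> tuples I A \<Longrightarrow> i \<in> I \<Longrightarrow> u \<in> carrier (A i) \<Longrightarrow> a(i := u) \<in> tuples I A"
  by (auto simp: tuples_def PiE_iff extensional_def)

text \<open>Isolating the factor at slot \<open>i\<close> reduces multilinearity of the Kronecker
  product to linearity of \<open>\<eta> i\<close>.\<close>

lemma kron_upd:
  assumes "i \<in> I" "s \<in> T" "t \<in> T"
  shows "kr (a(i := u)) s t = \<eta> i u (s i) (t i) * (\<Prod>j\<in>I - {i}. \<eta> j (a j) (s j) (t j))"
proof -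
  have "(\<Prod>j\<in>I - {i}. \<eta> j ((a(i := u)) j) (s j) (t j)) = (\<Prod>j\<in>I - {i}. \<eta> j (a j) (s j) (t j))"
    by (intro prod.cong) auto
  then show ?thesis
    using assms by (simp add: kron_def prod.remove[OF finite_sites assms(1)])
qed

lemma kron_upd_add:
  assumes "i \<in> I" "u \<in> carrier (A i)" "v \<in> carrier (A i)"
  shows "kr (a(i := u \<oplus>\<^bsub>A i\<^esub> v)) = (\<lambda>s t. kr (a(i := u)) s t + kr (a(i := v)) s t)"
proof (intro ext)
  fix s t
  show "kr (a(i := u \<oplus>\<^bsub>A i\<^esub> v)) s t = kr (a(i := u)) s t + kr (a(i := v)) s t"
  proof (cases "s \<in> T \<and> t \<in> T")
    case True
    then show ?thesis
      using assms by (simp add: kron_upd matrix_model.map_add[OF model] distrib_right)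
  qed (auto simp: kron_def)
qed

lemma kron_upd_smult:
  assumes "i \<in> I" "u \<in> carrier (A i)"
  shows "kr (a(i := c \<odot>\<^bsub>A i\<^esub> u)) = (\<lambda>s t. c * kr (a(i := u)) s t)"
proof (intro ext)
  fix s t
  show "kr (a(i := c \<odot>\<^bsub>A i\<^esub> u)) s t = c * kr (a(i := u)) s t"
  proof (cases "s \<in> T \<and> t \<in> T")
    case True
    then show ?thesis
      using assms by (simp add: kron_upd matrix_model.map_smult[OF model])
  qed (auto simp: kron_def)
qed

text \<open>The easy half of the kernel computation: multilinearity sends the generating relations
  to zero, and evaluation is linear.\<close>

lemma null_ev:
  assumes "f \<in> N"
  shows "f \<in> carrier F \<and> ev f = (\<lambda>s t. 0)"
  using assms
proof induction
  case (additive a i u v)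
  then show ?case
    by (simp add: F_diff F_delta tuple_upd matrix_model.add_closed[OF model] ev_diff ev_delta kron_upd_add)
next
  case (homogeneous a i u c)
  then show ?case
    by (simp add: F_diff F_scale F_delta tuple_upd matrix_model.smult_closed[OF model] ev_diff ev_scale
        ev_delta kron_upd_smult)
qed (simp_all add: F_zero ev_zero F_add F_scale ev_add ev_scale)

text \<open>Every slot carries a preimage of a matrix unit, so the Kronecker product is again a
  matrix unit. The corresponding pure tensors are a basis of the tensor product.\<close>

definition basis_tuple :: "('i \<Rightarrow> 'k) \<Rightarrow> ('i \<Rightarrow> 'k) \<Rightarrow> 'i \<Rightarrow> 'a" where
  "basis_tuple s t = (\<lambda>i\<in>I. matrix_model.elt (A i) (\<eta> i) (mat_unit (s i) (t i)))"

lemma mat_unit_closed: "i \<in> L \<Longrightarrow> j \<in> L \<Longrightarrow> mat_unit i j \<in> carrier (mat_alg L)"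
  by (simp add: mat_unit_def)

lemma basis_tuple_closed: "s \<in> T \<Longrightarrow> t \<in> T \<Longrightarrow> basis_tuple s t \<in> tuples I A"
  by (auto simp: basis_tuple_def tuples_def PiE_iff
      intro!: matrix_model.elt_closed[OF model] mat_unit_closed simp del: mat_alg_simps)

lemma kron_basis_tuple:
  assumes "s \<in> T" "t \<in> T"
  shows "kr (basis_tuple s t) = mat_unit s t"
proof (intro ext)
  fix s' t'
  show "kr (basis_tuple s t) s' t' = mat_unit s t s' t'"
  proof (cases "s' \<in> T \<and> t' \<in> T")
    case True
    have "\<eta> i (basis_tuple s t i) = mat_unit (s i) (t i)" if "i \<in> I" for i
      using assms that
      by (auto simp: basis_tuple_def PiE_iff intro!: matrix_model.map_elt[OF model] mat_unit_closed
          simp del: mat_alg_simps)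
    then have "kr (basis_tuple s t) s' t' = (\<Prod>i\<in>I. mat_unit (s i) (t i) (s' i) (t' i))"
      using True by (simp add: kron_def)
    also have "\<dots> = mat_unit s t s' t'"
    proof (cases "s' = s \<and> t' = t")
      case False
      then obtain i where "i \<in> I" "s' i \<noteq> s i \<or> t' i \<noteq> t i"
        using True assms by (meson PiE_ext)
      then have "\<exists>i\<in>I. mat_unit (s i) (t i) (s' i) (t' i) = 0"
        by (auto simp: mat_unit_def)
      then have "(\<Prod>i\<in>I. mat_unit (s i) (t i) (s' i) (t' i)) = 0"
        using finite_sites by (simp add: prod_zero)
      then show ?thesis
        using False by (auto simp: mat_unit_def)
    qed (simp add: mat_unit_def)
    finally show ?thesis .
  qed (use assms in \<open>auto simp: kron_def mat_unit_def\<close>)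
qed

lemma ev_surj: "m \<in> carrier (mat_alg T) \<Longrightarrow> \<exists>f\<in>carrier F. ev f = m"
proof (induction m rule: mat_alg_induct[OF finite_T, consumes 1, case_names zero unit add smult])
  case zero
  then show ?case using F_zero ev_zero by blast
next
  case (unit s t)
  then show ?case
    by (intro bexI[of _ "delta (basis_tuple s t)"])
      (simp_all add: ev_delta kron_basis_tuple F_delta basis_tuple_closed)
next
  case (add m n)
  then obtain f g where "f \<in> carrier F" "ev f = m" "g \<in> carrier F" "ev g = n"
    by blast
  then show ?case
    by (intro bexI[of _ "\<lambda>a. f a + g a"]) (simp_all add: ev_add F_add)
next
  case (smult c m)
  then obtain f where "f \<in> carrier F" "ev f = m"
    by blast
  then show ?case
    by (intro bexI[of _ "\<lambda>a. c * f a"]) (simp_all add: ev_scale F_scale)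
qed

definition normal_form :: "(('i \<Rightarrow> 'k) \<Rightarrow> ('i \<Rightarrow> 'k) \<Rightarrow> complex) \<Rightarrow> ('i, 'a) formal" where
  "normal_form m = (\<lambda>b. \<Sum>s\<in>T. \<Sum>t\<in>T. m s t * delta (basis_tuple s t) b)"

text \<open>The hard half of the kernel computation is phrased as a congruence because
  \<open>normal_form\<close> depends only on the matrix of \<open>f\<close>. If that matrix is zero,
  so is the normal form, and the congruence puts \<open>f\<close> itself into the span of the
  relations.\<close>

definition reducible :: "('i, 'a) formal \<Rightarrow> bool" where
  "reducible f \<longleftrightarrow> (\<lambda>b. f b - normal_form (ev f) b) \<in> N"

lemma reducible_add:
  assumes "f \<in> carrier F" "g \<in> carrier F" "reducible f" "reducible g"
  shows "reducible (\<lambda>b. f b + g b)"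
  using tensor_null.add[OF assms(3,4)[unfolded reducible_def]]
  by (simp add: reducible_def ev_add assms normal_form_def algebra_simps sum.distrib)

lemma reducible_scale:
  assumes "f \<in> carrier F" "reducible f"
  shows "reducible (\<lambda>b. c * f b)"
  using tensor_null.scale[OF assms(2)[unfolded reducible_def], of c]
  by (simp add: reducible_def ev_scale assms normal_form_def right_diff_distrib sum_distrib_left mult.assoc)

lemma reducible_null: "f \<in> N \<Longrightarrow> reducible f"
  using null_ev by (simp add: reducible_def normal_form_def)

lemma reducible_basis_tuple:
  assumes "s \<in> T" "t \<in> T"
  shows "reducible (delta (basis_tuple s t))"
proof -
  have "normal_form (mat_unit s t) b = delta (basis_tuple s t) b" for b
  proof -
    have "normal_form (mat_unit s t) b
        = (\<Sum>s'\<in>T. if s' = s then \<Sum>t'\<in>T. if t' = t then delta (basis_tuple s t) b else 0 else 0)"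
      unfolding normal_form_def by (intro sum.cong refl) (auto simp: mat_unit_def intro!: sum.cong sum.neutral)
    then show ?thesis
      using assms finite_T by simp
  qed
  then show ?thesis
    by (simp add: reducible_def ev_delta kron_basis_tuple assms tensor_null.zero)
qed

text \<open>The slots in \<open>J\<close> are expanded into matrix units one by one.\<close>

lemma reducible_slots:
  assumes "finite J" "J \<subseteq> I" "a \<in> tuples I A"
    "\<And>i. i \<in> I - J \<Longrightarrow> \<exists>p\<in>K i. \<exists>q\<in>K i. a i = matrix_model.elt (A i) (\<eta> i) (mat_unit p q)"
  shows "reducible (delta a)"
  using assms
proof (induction J arbitrary: a rule: finite_induct)
  case empty
  then have "\<forall>i\<in>I. \<exists>r. fst r \<in> K i \<and> snd r \<in> K i \<and>
      a i = matrix_model.elt (A i) (\<eta> i) (mat_unit (fst r) (snd r))"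
    by fastforce
  from bchoice[OF this] obtain r where
    r: "\<And>i. i \<in> I \<Longrightarrow> fst (r i) \<in> K i \<and> snd (r i) \<in> K i \<and>
      a i = matrix_model.elt (A i) (\<eta> i) (mat_unit (fst (r i)) (snd (r i)))"
    by blast
  define s t where "s = (\<lambda>i\<in>I. fst (r i))" and "t = (\<lambda>i\<in>I. snd (r i))"
  have st: "s \<in> T" "t \<in> T"
    using r by (auto simp: s_def t_def)
  have "a = basis_tuple s t"
    using r empty.prems(2) by (intro ext) (auto simp: basis_tuple_def s_def t_def tuples_def PiE_iff extensional_def)
  with st show ?case
    by (simp add: reducible_basis_tuple)
next
  case (insert j J)
  interpret Aj: matrix_model "A j" "K j" "\<eta> j"
    using insert.prems by (intro model) auto
  note [simp del] = mat_alg_simps(1)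
  have j: "j \<in> I"
    using insert.prems by auto
  have aj: "a j \<in> carrier (A j)"
    using insert.prems(2) j by (auto simp: tuples_def)
  have upd: "delta (a(j := u)) \<in> carrier F" if "u \<in> carrier (A j)" for u
    using insert.prems(2) j that by (intro F_delta tuple_upd)
  have red: "reducible (delta (a(j := Aj.elt m)))" if "m \<in> carrier (mat_alg (K j))" for m
    using that
  proof (induction m rule: mat_alg_induct[OF Aj.finite_index, consumes 1, case_names zero unit add smult])
    case zero
    \<comment> \<open>A zero in slot \<open>j\<close> is written as the scalar 0 times
      \<open>a j\<close>; the homogeneity relation for that scalar is the tuple itself, which is
      therefore null.\<close>
    have "Aj.elt (\<lambda>i k. 0) = 0 \<odot>\<^bsub>A j\<^esub> a j"
      using Aj.elt_smult[OF Aj.map_closed[OF aj], of 0] aj by (simp add: Aj.elt_map)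
    moreover have "delta (a(j := 0 \<odot>\<^bsub>A j\<^esub> a j)) \<in> N"
      using tensor_null.homogeneous[OF insert.prems(2) j aj, of 0] by (simp del: fun_upd_apply)
    ultimately show ?case
      by (metis reducible_null)
  next
    case (unit p q)
    show ?case
    proof (rule insert.IH)
      show "a(j := Aj.elt (mat_unit p q)) \<in> tuples I A"
        using insert.prems(2) j unit by (intro tuple_upd Aj.elt_closed mat_unit_closed)
      show "\<exists>p'\<in>K i. \<exists>q'\<in>K i. (a(j := Aj.elt (mat_unit p q))) i
          = matrix_model.elt (A i) (\<eta> i) (mat_unit p' q')" if "i \<in> I - J" for i
        using insert.prems(3)[of i] that unit by (cases "i = j") auto
    qed (use insert.prems in auto)
  next
    case (add m n)
    let ?u = "Aj.elt m" and ?v = "Aj.elt n"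
    have uv: "?u \<in> carrier (A j)" "?v \<in> carrier (A j)"
      using add by (simp_all add: Aj.elt_closed)
    \<comment> \<open>The tuple with a sum in slot \<open>j\<close> equals this relation plus the
      two tuples with one summand each, and all three parts are reducible.\<close>
    let ?r = "\<lambda>b. delta (a(j := ?u \<oplus>\<^bsub>A j\<^esub> ?v)) b - delta (a(j := ?u)) b - delta (a(j := ?v)) b"
    have "?r \<in> N"
      using insert.prems(2) j uv by (rule tensor_null.additive)
    then have "reducible ?r" "?r \<in> carrier F"
      using null_ev by (blast intro: reducible_null)+
    moreover have "reducible (\<lambda>b. delta (a(j := ?u)) b + delta (a(j := ?v)) b)"
      using reducible_add[OF upd[OF uv(1)] upd[OF uv(2)]] add by blast
    ultimately have "reducible (\<lambda>b. ?r b + (delta (a(j := ?u)) b + delta (a(j := ?v)) b))"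
      by (intro reducible_add[OF _ F_add[OF upd[OF uv(1)] upd[OF uv(2)]]])
    then show ?case
      using add by (simp add: Aj.elt_add del: fun_upd_apply)
  next
    case (smult c m)
    let ?u = "Aj.elt m"
    have u: "?u \<in> carrier (A j)"
      using smult by (simp add: Aj.elt_closed)
    let ?r = "\<lambda>b. delta (a(j := c \<odot>\<^bsub>A j\<^esub> ?u)) b - c * delta (a(j := ?u)) b"
    have "?r \<in> N"
      using insert.prems(2) j u by (rule tensor_null.homogeneous)
    then have "reducible ?r" "?r \<in> carrier F"
      using null_ev by (blast intro: reducible_null)+
    moreover have "reducible (\<lambda>b. c * delta (a(j := ?u)) b)"
      using reducible_scale[OF upd[OF u]] smult by blast
    ultimately have "reducible (\<lambda>b. ?r b + c * delta (a(j := ?u)) b)"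
      by (intro reducible_add[OF _ F_scale[OF upd[OF u]]])
    then show ?case
      using smult by (simp add: Aj.elt_smult del: fun_upd_apply)
  qed
  show ?case
    using red[OF Aj.map_closed[OF aj]] by (simp add: Aj.elt_map[OF aj])
qed

lemma reducible: "f \<in> carrier F \<Longrightarrow> reducible f"
proof (induction f rule: F_induct)
  case zero
  show ?case by (intro reducible_null tensor_null.zero)
next
  case (add g c a)
  have "reducible (delta a)"
    by (rule reducible_slots[OF finite_sites order_refl]) (use add in auto)
  from reducible_add[OF add(1) F_scale[OF F_delta[OF add(2)]] add(3) reducible_scale[OF F_delta[OF add(2)] this]]
  show ?case .
qed

lemma null_iff: "f \<in> N \<longleftrightarrow> f \<in> carrier F \<and> ev f = (\<lambda>s t. 0)"
proof
  assume f: "f \<in> carrier F \<and> ev f = (\<lambda>s t. 0)"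
  then have "(\<lambda>b. f b - normal_form (\<lambda>s t. 0) b) \<in> N"
    using reducible[of f] by (simp only: reducible_def)
  then show "f \<in> N"
    by (simp add: normal_form_def)
qed (rule null_ev)

end

section \<open>The quotient algebra computed through fibres of the evaluation\<close>

lemma with_norm_simps [simp]:
  "carrier (with_norm R n) = carrier R" "mult (with_norm R n) = mult R" "one (with_norm R n) = one R"
  "zero (with_norm R n) = zero R" "add (with_norm R n) = add R" "smult (with_norm R n) = smult R"
  "star (with_norm R n) = star R"
  by (simp_all add: with_norm_def star_alg.extend_def cstar_alg.fields_def)

lemma UN_eq_const: "X \<noteq> {} \<Longrightarrow> (\<And>x. x \<in> X \<Longrightarrow> g x = Y) \<Longrightarrow> (\<Union>x\<in>X. g x) = Y"
  by auto

context tensor_model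
begin

text \<open>As a map from matrices to cosets this is the inverse of \<open>tensor_mat\<close>, so
  every operation of the quotient can be computed on matrices.\<close>

definition fibre :: "(('i \<Rightarrow> 'k) \<Rightarrow> ('i \<Rightarrow> 'k) \<Rightarrow> complex) \<Rightarrow> ('i, 'a) tensor" where
  "fibre m = {f \<in> carrier F. ev f = m}"

lemma fibre_nonempty: "m \<in> carrier (mat_alg T) \<Longrightarrow> fibre m \<noteq> {}"
  using ev_surj by (auto simp: fibre_def simp del: mat_alg_simps)

lemma F_add_apply: "f \<oplus>\<^bsub>F\<^esub> g = (\<lambda>a. f a + g a)"
  by (simp add: formal_sums_def)

text \<open>Two formal sums have the same matrix exactly when their difference lies in the kernel,
  which \<open>null_iff\<close> identifies with the span of the relations.\<close>

lemma coset_eq_fibre: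
  assumes "f \<in> carrier F"
  shows "N +>\<^bsub>F\<^esub> f = fibre (ev f)"
proof (intro equalityI subsetI)
  fix g assume "g \<in> N +>\<^bsub>F\<^esub> f"
  then obtain h where h: "h \<in> N" "g = (\<lambda>a. h a + f a)"
    by (auto simp: a_r_coset_def' F_add_apply)
  then have "h \<in> carrier F" "ev h = (\<lambda>s t. 0)"
    by (simp_all add: null_iff)
  then show "g \<in> fibre (ev f)"
    using assms by (simp add: h(2) fibre_def F_add ev_add)
next
  fix g assume "g \<in> fibre (ev f)"
  then have g: "g \<in> carrier F" "ev g = ev f"
    by (simp_all add: fibre_def)
  then have "(\<lambda>a. g a - f a) \<in> N"
    using assms by (simp add: null_iff F_diff ev_diff)
  moreover have "g = (\<lambda>a. g a - f a) \<oplus>\<^bsub>F\<^esub> f"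
    by (simp add: F_add_apply)
  ultimately show "g \<in> N +>\<^bsub>F\<^esub> f"
    unfolding a_r_coset_def' by blast
qed

text \<open>The quotient operations are unions over all representatives. If the matrix of
  \<open>h f\<close> depends only on that of \<open>f\<close>, all members of the union are the same
  coset and it collapses to one fibre.\<close>

lemma fibre_union:
  assumes "m \<in> carrier (mat_alg T)" "\<And>f. f \<in> carrier F \<Longrightarrow> ev f = m \<Longrightarrow> h f \<in> carrier F \<and> ev (h f) = n"
  shows "(\<Union>f\<in>fibre m. N +>\<^bsub>F\<^esub> h f) = fibre n"
  by (rule UN_eq_const[OF fibre_nonempty[OF assms(1)]])
    (use assms(2) in \<open>auto simp: fibre_def coset_eq_fibre\<close>)

lemma tensor_mat_fibre:
  assumes "m \<in> carrier (mat_alg T)"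
  shows "tensor_mat I K \<eta> (fibre m) = m"
proof -
  have "(SOME f. f \<in> fibre m) \<in> fibre m"
    using fibre_nonempty[OF assms] by (simp add: some_in_eq)
  then show ?thesis
    by (simp add: tensor_mat_def fibre_def)
qed

text \<open>Product and involution of formal sums both push weights forward along a map into tuples,
  collecting the weights that land on the same tuple. Evaluation undoes the collecting and leaves a
  plain sum over \<open>P\<close>.\<close>

lemma ev_pushforward:
  assumes "finite P" "h ` P \<subseteq> tuples I A"
  shows "(\<lambda>c. \<Sum>p\<in>{p \<in> P. h p = c}. w p) \<in> carrier F"
    and "ev (\<lambda>c. \<Sum>p\<in>{p \<in> P. h p = c}. w p) = (\<lambda>s t. \<Sum>p\<in>P. w p * kr (h p) s t)"
proof -
  let ?f = "\<lambda>c. \<Sum>p\<in>{p \<in> P. h p = c}. w p"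
  have supp: "{c. ?f c \<noteq> 0} \<subseteq> h ` P"
  proof
    fix c assume "c \<in> {c. ?f c \<noteq> 0}"
    then have "{p \<in> P. h p = c} \<noteq> {}"
      by (metis (mono_tags, lifting) mem_Collect_eq sum.empty)
    then show "c \<in> h ` P"
      by auto
  qed
  then show "?f \<in> carrier F"
    using assms unfolding F_carrier by (meson finite_imageI finite_subset order_trans)
  show "ev ?f = (\<lambda>s t. \<Sum>p\<in>P. w p * kr (h p) s t)"
  proof (intro ext)
    fix s t
    have "ev ?f s t = (\<Sum>c\<in>h ` P. ?f c * kr c s t)"
      using assms(1) supp by (intro ev_superset) auto
    also have "\<dots> = (\<Sum>c\<in>h ` P. \<Sum>p\<in>{p \<in> P. h p = c}. w p * kr (h p) s t)"
      by (simp add: sum_distrib_right)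
    also have "\<dots> = (\<Sum>p\<in>P. w p * kr (h p) s t)"
      using assms(1) by (intro sum.group) auto
    finally show "ev ?f s t = (\<Sum>p\<in>P. w p * kr (h p) s t)" .
  qed
qed

text \<open>The mixed-product rule for Kronecker products: expanding the product over sites of sums
  over \<open>K i\<close> gives a single sum over configurations in \<open>T\<close>.\<close>

lemma kron_mult:
  assumes "a \<in> tuples I A" "b \<in> tuples I A"
  shows "kr (\<lambda>i\<in>I. a i \<otimes>\<^bsub>A i\<^esub> b i) = kr a \<otimes>\<^bsub>mat_alg T\<^esub> kr b"
proof (intro ext)
  fix s t
  show "kr (\<lambda>i\<in>I. a i \<otimes>\<^bsub>A i\<^esub> b i) s t = (kr a \<otimes>\<^bsub>mat_alg T\<^esub> kr b) s t"
  proof (cases "s \<in> T \<and> t \<in> T")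
    case True
    have "a i \<in> carrier (A i)" "b i \<in> carrier (A i)" if "i \<in> I" for i
      using assms that by (auto simp: tuples_def)
    then have "(\<Prod>i\<in>I. \<eta> i ((\<lambda>i\<in>I. a i \<otimes>\<^bsub>A i\<^esub> b i) i) (s i) (t i))
        = (\<Prod>i\<in>I. \<Sum>k\<in>K i. \<eta> i (a i) (s i) k * \<eta> i (b i) k (t i))"
      by (intro prod.cong) (simp_all add: matrix_model.map_mult[OF model])
    also have "\<dots> = (\<Sum>k\<in>T. \<Prod>i\<in>I. \<eta> i (a i) (s i) (k i) * \<eta> i (b i) (k i) (t i))"
      by (intro prod_sum_PiE finite_sites matrix_model.finite_index[OF model])
    finally show ?thesis
      using True by (simp add: kron_def prod.distrib)
  next
    case False
    then show ?thesis
      by (cases "s \<in> T") (simp_all add: kron_def)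
  qed
qed

lemma kron_star:
  assumes "a \<in> tuples I A"
  shows "kr (\<lambda>i\<in>I. star (A i) (a i)) = star (mat_alg T) (kr a)"
proof -
  have "a i \<in> carrier (A i)" if "i \<in> I" for i
    using assms that by (auto simp: tuples_def)
  then have "(\<Prod>i\<in>I. \<eta> i ((\<lambda>i\<in>I. star (A i) (a i)) i) (s i) (t i)) = cnj (\<Prod>i\<in>I. \<eta> i (a i) (t i) (s i))"
    for s t
    unfolding cnj_prod by (intro prod.cong) (simp_all add: matrix_model.map_star[OF model])
  then show ?thesis
    by (auto simp: kron_def fun_eq_iff simp del: restrict_apply cnj_prod)
qed

lemma kron_one: "kr (\<lambda>i\<in>I. \<one>\<^bsub>A i\<^esub>) = \<one>\<^bsub>mat_alg T\<^esub>"
proof (intro ext)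
  fix s t
  show "kr (\<lambda>i\<in>I. \<one>\<^bsub>A i\<^esub>) s t = \<one>\<^bsub>mat_alg T\<^esub> s t"
  proof (cases "s \<in> T \<and> t \<in> T")
    case True
    then have "kr (\<lambda>i\<in>I. \<one>\<^bsub>A i\<^esub>) s t = (\<Prod>i\<in>I. if s i = t i then 1 else 0)"
      unfolding kron_def by (auto simp: matrix_model.map_one[OF model] intro!: prod.cong)
    also have "\<dots> = (if s = t then 1 else 0)"
    proof (cases "s = t")
      case False
      then obtain i where "i \<in> I" "s i \<noteq> t i"
        using True by (meson PiE_ext)
      then have "(\<Prod>i\<in>I. if s i = t i then 1 else 0) = (0::complex)"
        using finite_sites by (intro prod_zero) auto
      with False show ?thesis
        by simp
    qed simp
    finally show ?thesis
      using True by simp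
  next
    case False
    then show ?thesis
      by (cases "s \<in> T") (auto simp: kron_def)
  qed
qed

lemma F_mult:
  assumes "f \<in> carrier F" "g \<in> carrier F"
  shows "f \<otimes>\<^bsub>F\<^esub> g \<in> carrier F" "ev (f \<otimes>\<^bsub>F\<^esub> g) = ev f \<otimes>\<^bsub>mat_alg T\<^esub> ev g"
proof -
  let ?S = "{a. f a \<noteq> 0}" and ?S' = "{a. g a \<noteq> 0}"
  let ?h = "\<lambda>(a, b). \<lambda>i\<in>I. a i \<otimes>\<^bsub>A i\<^esub> b i"
  have fin: "finite ?S" "finite ?S'" and tup: "?S \<subseteq> tuples I A" "?S' \<subseteq> tuples I A"
    using assms by (simp_all add: F_carrier)
  have eq: "f \<otimes>\<^bsub>F\<^esub> g = (\<lambda>c. \<Sum>p\<in>{p \<in> ?S \<times> ?S'. ?h p = c}. f (fst p) * g (snd p))"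
    by (intro ext) (auto simp: formal_sums_def intro!: sum.cong)
  have P: "finite (?S \<times> ?S')" "?h ` (?S \<times> ?S') \<subseteq> tuples I A"
    using fin tup by (auto simp: tuples_def PiE_iff subset_iff intro!: matrix_model.mult_closed[OF model])
  from ev_pushforward(1)[OF P] show "f \<otimes>\<^bsub>F\<^esub> g \<in> carrier F"
    unfolding eq .
  show "ev (f \<otimes>\<^bsub>F\<^esub> g) = ev f \<otimes>\<^bsub>mat_alg T\<^esub> ev g"
  proof (intro ext)
    fix s t
    have "ev (f \<otimes>\<^bsub>F\<^esub> g) s t = (\<Sum>p\<in>?S \<times> ?S'. f (fst p) * g (snd p) * kr (?h p) s t)"
      unfolding eq ev_pushforward(2)[OF P] ..
    also have "\<dots> = (\<Sum>(a, b)\<in>?S \<times> ?S'. \<Sum>k\<in>T. (f a * kr a s k) * (g b * kr b k t))"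
    proof (intro sum.cong refl)
      fix p assume "p \<in> ?S \<times> ?S'"
      moreover obtain a b where p: "p = (a, b)"
        by (cases p)
      ultimately have "a \<in> tuples I A" "b \<in> tuples I A"
        using tup by blast+
      then show "f (fst p) * g (snd p) * kr (?h p) s t
          = (case p of (a, b) \<Rightarrow> \<Sum>k\<in>T. (f a * kr a s k) * (g b * kr b k t))"
        by (simp add: p kron_mult sum_distrib_left mult_ac del: restrict_apply)
    qed
    also have "\<dots> = (\<Sum>a\<in>?S. \<Sum>b\<in>?S'. \<Sum>k\<in>T. (f a * kr a s k) * (g b * kr b k t))"
      by (rule sum.cartesian_product[symmetric])
    also have "\<dots> = (\<Sum>k\<in>T. \<Sum>a\<in>?S. \<Sum>b\<in>?S'. (f a * kr a s k) * (g b * kr b k t))"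
      by (subst sum.swap, subst sum.swap[of _ _ ?S]) (intro sum.cong refl sum.swap)
    also have "\<dots> = (ev f \<otimes>\<^bsub>mat_alg T\<^esub> ev g) s t"
      by (simp add: formal_mat_def sum_product)
    finally show "ev (f \<otimes>\<^bsub>F\<^esub> g) s t = (ev f \<otimes>\<^bsub>mat_alg T\<^esub> ev g) s t" .
  qed
qed

lemma F_star:
  assumes "f \<in> carrier F"
  shows "star F f \<in> carrier F" "ev (star F f) = star (mat_alg T) (ev f)"
proof -
  let ?S = "{a. f a \<noteq> 0}" and ?h = "\<lambda>a. \<lambda>i\<in>I. star (A i) (a i)"
  have eq: "star F f = (\<lambda>c. \<Sum>a\<in>{a \<in> ?S. ?h a = c}. cnj (f a))"
    by (simp add: formal_sums_def)
  have P: "finite ?S" "?h ` ?S \<subseteq> tuples I A"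
    using assms by (auto simp: F_carrier tuples_def PiE_iff subset_iff intro!: matrix_model.star_closed[OF model])
  from ev_pushforward(1)[OF P] show "star F f \<in> carrier F"
    unfolding eq .
  have "kr (?h a) = star (mat_alg T) (kr a)" if "a \<in> ?S" for a
    using assms that by (intro kron_star) (auto simp: F_carrier)
  then show "ev (star F f) = star (mat_alg T) (ev f)"
    unfolding eq ev_pushforward(2)[OF P] by (auto simp: formal_mat_def cnj_sum intro!: ext sum.cong)
qed

lemma F_smult: "c \<odot>\<^bsub>F\<^esub> f = (\<lambda>a. c * f a)"
  by (simp add: formal_sums_def)

lemma F_one: "\<one>\<^bsub>F\<^esub> = delta (\<lambda>i\<in>I. \<one>\<^bsub>A i\<^esub>)"
  by (simp add: formal_sums_def)

lemma one_tuple: "(\<lambda>i\<in>I. \<one>\<^bsub>A i\<^esub>) \<in> tuples I A"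
  by (auto simp: tuples_def intro!: matrix_model.one_closed[OF model])

lemma tensor_carrier: "carrier (tensor I A) = fibre ` carrier (mat_alg T)"
proof -
  have "carrier (tensor I A) = (\<lambda>f. N +>\<^bsub>F\<^esub> f) ` carrier F"
    by (auto simp: tensor_def tensor_star_alg_def Let_def FactRing_def A_RCOSETS_def')
  also have "\<dots> = (\<lambda>f. fibre (ev f)) ` carrier F"
    by (simp add: coset_eq_fibre cong: image_cong)
  also have "\<dots> = fibre ` carrier (mat_alg T)"
    using ev_closed ev_surj by (auto simp del: mat_alg_simps)
  finally show ?thesis .
qed

lemma mat_mult_closed:
  assumes "m \<in> carrier (mat_alg T)" "n \<in> carrier (mat_alg T)"
  shows "m \<otimes>\<^bsub>mat_alg T\<^esub> n \<in> carrier (mat_alg T)"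
proof -
  obtain f g where "f \<in> carrier F" "ev f = m" "g \<in> carrier F" "ev g = n"
    using assms ev_surj by metis
  then show ?thesis
    using ev_closed[OF F_mult(1)[of f g]] by (simp only: F_mult(2))
qed

lemma tensor_one: "\<one>\<^bsub>tensor I A\<^esub> = fibre \<one>\<^bsub>mat_alg T\<^esub>"
  by (simp add: tensor_def tensor_star_alg_def Let_def FactRing_def F_one F_delta one_tuple
      coset_eq_fibre ev_delta kron_one del: mat_alg_simps)

lemma tensor_add:
  assumes "m \<in> carrier (mat_alg T)" "n \<in> carrier (mat_alg T)"
  shows "fibre m \<oplus>\<^bsub>tensor I A\<^esub> fibre n = fibre (m \<oplus>\<^bsub>mat_alg T\<^esub> n)"
proof -
  have "fibre m \<oplus>\<^bsub>tensor I A\<^esub> fibre n = (\<Union>f\<in>fibre m. \<Union>g\<in>fibre n. {\<lambda>a. f a + g a})"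
    by (simp add: tensor_def tensor_star_alg_def Let_def FactRing_def set_add_def' F_add_apply)
  also have "\<dots> = fibre (\<lambda>s t. m s t + n s t)"
  proof (intro equalityI subsetI)
    fix h assume h: "h \<in> fibre (\<lambda>s t. m s t + n s t)"
    \<comment> \<open>The quotient adds cosets as sets, so every \<open>h\<close> in the fibre of
      the sum must be split: any fixed \<open>f\<close> over \<open>m\<close> leaves
      \<open>h - f\<close> over \<open>n\<close>.\<close>
    obtain f where f: "f \<in> carrier F" "ev f = m"
      using ev_surj[OF assms(1)] by blast
    have "(\<lambda>a. h a - f a) \<in> fibre n"
      using h f by (simp add: fibre_def F_diff ev_diff)
    moreover have "h = (\<lambda>a. f a + (h a - f a))"
      by simp
    ultimately show "h \<in> (\<Union>f\<in>fibre m. \<Union>g\<in>fibre n. {\<lambda>a. f a + g a})"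
      using f unfolding fibre_def by blast
  qed (auto simp: fibre_def F_add ev_add)
  finally show ?thesis
    by simp
qed

lemma tensor_mult:
  assumes "m \<in> carrier (mat_alg T)" "n \<in> carrier (mat_alg T)"
  shows "fibre m \<otimes>\<^bsub>tensor I A\<^esub> fibre n = fibre (m \<otimes>\<^bsub>mat_alg T\<^esub> n)"
proof -
  have "fibre m \<otimes>\<^bsub>tensor I A\<^esub> fibre n = (\<Union>f\<in>fibre m. \<Union>g\<in>fibre n. N +>\<^bsub>F\<^esub> (f \<otimes>\<^bsub>F\<^esub> g))"
    by (simp add: tensor_def tensor_star_alg_def Let_def FactRing_def rcoset_mult_def)
  also have "\<dots> = fibre (m \<otimes>\<^bsub>mat_alg T\<^esub> n)"
  proof (rule UN_eq_const[OF fibre_nonempty[OF assms(1)]])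
    fix f assume "f \<in> fibre m"
    then show "(\<Union>g\<in>fibre n. N +>\<^bsub>F\<^esub> (f \<otimes>\<^bsub>F\<^esub> g)) = fibre (m \<otimes>\<^bsub>mat_alg T\<^esub> n)"
      by (intro fibre_union assms(2)) (auto simp: fibre_def F_mult simp del: mat_alg_simps)
  qed
  finally show ?thesis .
qed

lemma tensor_smult:
  assumes "m \<in> carrier (mat_alg T)"
  shows "c \<odot>\<^bsub>tensor I A\<^esub> fibre m = fibre (c \<odot>\<^bsub>mat_alg T\<^esub> m)"
proof -
  have "c \<odot>\<^bsub>tensor I A\<^esub> fibre m = (\<Union>f\<in>fibre m. N +>\<^bsub>F\<^esub> (c \<odot>\<^bsub>F\<^esub> f))"
    by (simp add: tensor_def tensor_star_alg_def Let_def)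
  also have "\<dots> = fibre (c \<odot>\<^bsub>mat_alg T\<^esub> m)"
    by (intro fibre_union assms) (simp add: F_smult F_scale ev_scale)
  finally show ?thesis .
qed

lemma tensor_star:
  assumes "m \<in> carrier (mat_alg T)"
  shows "star (tensor I A) (fibre m) = fibre (star (mat_alg T) m)"
proof -
  have "star (tensor I A) (fibre m) = (\<Union>f\<in>fibre m. N +>\<^bsub>F\<^esub> star F f)"
    by (simp add: tensor_def tensor_star_alg_def Let_def)
  also have "\<dots> = fibre (star (mat_alg T) m)"
    by (intro fibre_union assms) (simp add: F_star)
  finally show ?thesis .
qed

text \<open>Models are stable under tensor products. This is applied to the sites of a region and
  then once more to the two resulting algebras inside \<open>tensor2\<close>.\<close>

lemma tensor_matrix_model: "matrix_model (tensor I A) T (tensor_mat I K \<eta>)"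
proof -
  have carrierI: "m \<in> carrier (mat_alg T) \<Longrightarrow> fibre m \<in> carrier (tensor I A)" for m
    unfolding tensor_carrier by (rule imageI)
  have carrierE: "\<exists>m\<in>carrier (mat_alg T). x = fibre m" if "x \<in> carrier (tensor I A)" for x
    using that unfolding tensor_carrier by blast
  note facts = tensor_one tensor_add tensor_mult tensor_smult tensor_star
    tensor_mat_fibre mat_alg_closed mat_mult_closed carrierI
  note [simp del] = mat_alg_simps
  have bij: "bij_betw (tensor_mat I K \<eta>) (carrier (tensor I A)) (carrier (mat_alg T))"
    by (rule bij_betw_byWitness[where f' = fibre]) (auto simp: facts dest!: carrierE)
  show ?thesis
  proof (rule matrix_model.intro)
    show "star_iso (tensor I A) (mat_alg T) (tensor_mat I K \<eta>)"
      unfolding star_iso_def star_hom_def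
      using bij by (auto simp: facts dest!: carrierE)
  qed (auto simp: facts finite_T dest!: carrierE)
qed

lemma pure_tensor_closed: "a \<in> tuples I A \<Longrightarrow> pure_tensor I A a \<in> carrier (tensor I A)"
  by (auto simp: pure_tensor_def tensor_carrier coset_eq_fibre F_delta ev_delta intro!: imageI kron_closed
      simp del: mat_alg_simps)

lemma tensor_mat_pure: "a \<in> tuples I A \<Longrightarrow> tensor_mat I K \<eta> (pure_tensor I A a) = kr a"
  by (simp add: pure_tensor_def coset_eq_fibre F_delta ev_delta tensor_mat_fibre kron_closed
      del: mat_alg_simps)

end

section \<open>Matrix models and the splitting isomorphism\<close>

lemma matrix_model_iso_exists:
  assumes "matrix_model R K \<eta>" "matrix_model R' K \<eta>'"
  obtains p where "star_iso R R' p" "\<And>x. x \<in> carrier R \<Longrightarrow> \<eta>' (p x) = \<eta> x"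
    "p \<in> extensional (carrier R)"
proof -
  interpret R: matrix_model R K \<eta>
    by fact
  interpret R': matrix_model R' K \<eta>'
    by fact
  note [simp del] = mat_alg_simps
  \<comment> \<open>The restriction to the carrier supplies the extensionality by which
    \<open>splitting\<close> singles out its map.\<close>
  define p where "p = (\<lambda>x\<in>carrier R. R'.elt (\<eta> x))"
  have p: "p x \<in> carrier R'" "\<eta>' (p x) = \<eta> x" if "x \<in> carrier R" for x
    using that by (simp_all add: p_def R'.elt_closed R'.map_elt R.map_closed)
  have "star_hom R R' p"
    unfolding star_hom_def
  proof (intro conjI ballI allI)
    fix x y c assume xy: "x \<in> carrier R" "y \<in> carrier R"
    show "p (x \<oplus>\<^bsub>R\<^esub> y) = p x \<oplus>\<^bsub>R'\<^esub> p y"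
      by (rule R'.map_inj) (use xy in \<open>simp_all add: p R.add_closed R'.add_closed R.map_add R'.map_add\<close>)
    show "p (x \<otimes>\<^bsub>R\<^esub> y) = p x \<otimes>\<^bsub>R'\<^esub> p y"
      by (rule R'.map_inj) (use xy in \<open>simp_all add: p R.mult_closed R'.mult_closed R.map_mult R'.map_mult\<close>)
  next
    fix x c assume x: "x \<in> carrier R"
    show "p (c \<odot>\<^bsub>R\<^esub> x) = c \<odot>\<^bsub>R'\<^esub> p x"
      by (rule R'.map_inj) (use x in \<open>simp_all add: p R.smult_closed R'.smult_closed R.map_smult R'.map_smult\<close>)
    show "p (star R x) = star R' (p x)"
      by (rule R'.map_inj) (use x in \<open>simp_all add: p R.star_closed R'.star_closed R.map_star R'.map_star\<close>)
  qed (use p in auto)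
  moreover have "bij_betw p (carrier R) (carrier R')"
  proof (rule bij_betw_byWitness[where f' = "\<lambda>y. R.elt (\<eta>' y)"])
    show "\<forall>x\<in>carrier R. R.elt (\<eta>' (p x)) = x"
      by (simp add: p R.elt_map)
    show "\<forall>y\<in>carrier R'. p (R.elt (\<eta>' y)) = y"
      by (simp add: p_def R.elt_closed R.map_elt R'.elt_map R'.map_closed)
    show "p ` carrier R \<subseteq> carrier R'"
      using p by blast
    show "(\<lambda>y. R.elt (\<eta>' y)) ` carrier R' \<subseteq> carrier R"
      using R.elt_closed R'.map_closed by blast
  qed
  ultimately have "star_iso R R' p"
    by (simp add: star_iso_def)
  with p that show ?thesis
    by (simp add: p_def)
qed

definition reindex_mat ::
  "'j set \<Rightarrow> ('j \<Rightarrow> 'k) \<Rightarrow> ('k \<Rightarrow> 'k \<Rightarrow> complex) \<Rightarrow> 'j \<Rightarrow> 'j \<Rightarrow> complex" where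
  "reindex_mat J \<beta> m = (\<lambda>i j. if i \<in> J \<and> j \<in> J then m (\<beta> i) (\<beta> j) else 0)"

text \<open>Relabelling along a bijection is conjugation by a permutation matrix. It reconciles
  configurations on \<open>M\<close> with pairs of configurations on \<open>L\<close> and
  \<open>M - L\<close>.\<close>

lemma matrix_model_reindex:
  assumes "matrix_model R K \<eta>" and \<beta>: "bij_betw \<beta> J K"
  shows "matrix_model R J (\<lambda>x. reindex_mat J \<beta> (\<eta> x))"
proof -
  interpret matrix_model R K \<eta>
    by fact
  let ?r = "reindex_mat J \<beta>"
  have fin: "finite J"
    using \<beta> finite_index bij_betw_finite by blast
  have \<beta>J: "\<beta> i \<in> K" if "i \<in> J" for i
    using \<beta> that bij_betwE by blast
  have inj: "\<beta> i = \<beta> j \<longleftrightarrow> i = j" if "i \<in> J" "j \<in> J" for i j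
    using \<beta> that by (auto simp: bij_betw_def inj_on_def)
  define \<gamma> where "\<gamma> = inv_into J \<beta>"
  have \<gamma>: "\<gamma> k \<in> J" "\<beta> (\<gamma> k) = k" if "k \<in> K" for k
    using \<beta> that bij_betw_def inv_into_into f_inv_into_f unfolding \<gamma>_def by metis+
  have \<gamma>\<beta>: "\<gamma> (\<beta> j) = j" if "j \<in> J" for j
    using \<beta> that unfolding \<gamma>_def by (rule bij_betw_inv_into_left)
  have closed: "?r m \<in> carrier (mat_alg J)" for m
    by (simp add: reindex_mat_def)
  have bij: "bij_betw ?r (carrier (mat_alg K)) (carrier (mat_alg J))"
  proof (rule bij_betw_byWitness[where f' = "reindex_mat K \<gamma>"])
    have zero: "m i j = 0" if "m \<in> carrier (mat_alg L)" "\<not> (i \<in> L \<and> j \<in> L)"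
      for m i j and L :: "'x set"
      using that unfolding mat_alg_simps(1) by blast
    show "\<forall>m\<in>carrier (mat_alg K). reindex_mat K \<gamma> (?r m) = m"
      by (auto simp: reindex_mat_def \<gamma> zero simp del: mat_alg_simps intro!: ext)
    show "\<forall>m\<in>carrier (mat_alg J). ?r (reindex_mat K \<gamma> m) = m"
      by (auto simp: reindex_mat_def \<gamma>\<beta> \<beta>J zero simp del: mat_alg_simps intro!: ext)
  qed (auto simp: reindex_mat_def)
  have mult: "?r (m \<otimes>\<^bsub>mat_alg K\<^esub> n) = ?r m \<otimes>\<^bsub>mat_alg J\<^esub> ?r n" for m n
  proof (intro ext)
    fix i j
    show "?r (m \<otimes>\<^bsub>mat_alg K\<^esub> n) i j = (?r m \<otimes>\<^bsub>mat_alg J\<^esub> ?r n) i j"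
    proof (cases "i \<in> J \<and> j \<in> J")
      case True
      have "(\<Sum>k\<in>K. m (\<beta> i) k * n k (\<beta> j)) = (\<Sum>k\<in>J. m (\<beta> i) (\<beta> k) * n (\<beta> k) (\<beta> j))"
        by (rule sum.reindex_bij_betw[OF \<beta>, symmetric])
      with True show ?thesis
        by (simp add: reindex_mat_def)
    qed (auto simp: reindex_mat_def)
  qed
  have ops: "?r (m \<oplus>\<^bsub>mat_alg K\<^esub> n) = ?r m \<oplus>\<^bsub>mat_alg J\<^esub> ?r n"
    "?r (c \<odot>\<^bsub>mat_alg K\<^esub> m) = c \<odot>\<^bsub>mat_alg J\<^esub> ?r m"
    "?r (star (mat_alg K) m) = star (mat_alg J) (?r m)"
    "?r \<one>\<^bsub>mat_alg K\<^esub> = \<one>\<^bsub>mat_alg J\<^esub>" for m n c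
    by (auto simp: reindex_mat_def fun_eq_iff \<beta>J inj)
  show ?thesis
  proof (rule matrix_model.intro)
    have "bij_betw (\<lambda>x. ?r (\<eta> x)) (carrier R) (carrier (mat_alg J))"
      using bij_betw_trans[OF _ bij] iso by (auto simp: star_iso_def o_def)
    then show "star_iso R (mat_alg J) (\<lambda>x. ?r (\<eta> x))"
      unfolding star_iso_def star_hom_def
      by (auto simp: map_add map_mult map_smult map_star ops mult closed simp del: mat_alg_simps)
  qed (simp_all add: fin one_closed add_closed mult_closed smult_closed star_closed map_one ops
      del: mat_alg_simps)
qed

text \<open>Pure tensors of basis tuples are the preimages of the matrix units and hence span the
  algebra. This is the uniqueness behind the description of \<open>splitting\<close>.\<close>

lemma (in tensor_model) star_iso_eqI:
  assumes p: "star_iso (tensor I A) R p" "p \<in> extensional (carrier (tensor I A))"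
    and q: "star_iso (tensor I A) R q" "q \<in> extensional (carrier (tensor I A))"
    and eq: "\<And>a. a \<in> tuples I A \<Longrightarrow> p (pure_tensor I A a) = q (pure_tensor I A a)"
    and nonempty: "T \<noteq> {}"
  shows "p = q"
proof -
  interpret matrix_model "tensor I A" T "tensor_mat I K \<eta>"
    by (rule tensor_matrix_model)
  note [simp del] = mat_alg_simps
  have hom: "star_hom (tensor I A) R p" "star_hom (tensor I A) R q"
    using p q by (simp_all add: star_iso_def)
  have unit: "p (elt (mat_unit s t)) = q (elt (mat_unit s t))" if "s \<in> T" "t \<in> T" for s t
  proof -
    have "elt (mat_unit s t) = pure_tensor I A (basis_tuple s t)"
      using that
      by (intro map_inj)
        (simp_all add: map_elt elt_closed mat_unit_closed tensor_mat_pure kron_basis_tuple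
          basis_tuple_closed pure_tensor_closed)
    then show ?thesis
      using that by (simp add: eq basis_tuple_closed)
  qed
  have smult: "p (elt (\<lambda>s t. c * m s t)) = q (elt (\<lambda>s t. c * m s t))"
    if "m \<in> carrier (mat_alg T)" "p (elt m) = q (elt m)" for c m
    using that hom by (simp add: elt_smult star_hom_def elt_closed)
  have "p (elt m) = q (elt m)" if "m \<in> carrier (mat_alg T)" for m
    using that
  proof (induction m rule: mat_alg_induct[OF finite_T, consumes 1, case_names zero unit add smult])
    case zero
    \<comment> \<open>Preservation of zero is not part of \<open>star_hom\<close>, and nothing is
      assumed about \<open>R\<close>. So zero is treated as the scalar 0 times some matrix unit, for
      which \<open>T\<close> has to be nonempty.\<close>
    obtain s where "s \<in> T"
      using nonempty by blast
    then show ?case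
      using smult[of "mat_unit s s" 0] unit by (simp add: mat_unit_closed)
  next
    case (add m n)
    then show ?case
      using hom by (simp add: elt_add star_hom_def elt_closed)
  qed (simp_all add: unit smult)
  then have "p x = q x" if "x \<in> carrier (tensor I A)" for x
    using that by (metis elt_map map_closed)
  then show ?thesis
    using p q by (intro extensionalityI)
qed

section \<open>The chain and the matrix models of its local algebras\<close>

locale spin_chain =
  fixes A :: "int \<Rightarrow> 'a cstar_alg" and \<xi> :: "int \<Rightarrow> 'a \<Rightarrow> complex^2^2"
  assumes site_algebra: "\<And>x. unital_cstar_algebra (A x)"
    and site_iso: "\<And>x. star_iso (A x) mat2 (\<xi> x)"
begin

definition site_mat :: "int \<Rightarrow> 'a \<Rightarrow> 2 \<Rightarrow> 2 \<Rightarrow> complex" where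
  "site_mat x a = (\<lambda>i j. \<xi> x a $ i $ j)"

text \<open>\<open>star_iso\<close> does not mention identities. Surjectivity gives an
  \<open>a\<close> with image \<open>mat 1\<close>, and applying the homomorphism to the product of
  the identity with \<open>a\<close> forces the claim.\<close>

lemma site_one: "\<xi> x \<one>\<^bsub>A x\<^esub> = mat 1"
proof -
  interpret unital_cstar_algebra "A x"
    by (rule site_algebra)
  obtain a where a: "a \<in> carrier (A x)" "\<xi> x a = mat 1"
    using site_iso[of x] by (auto simp: star_iso_def bij_betw_def mat2_def) (metis UNIV_I imageE)
  have "\<forall>u\<in>carrier (A x). \<forall>v\<in>carrier (A x). \<xi> x (u \<otimes>\<^bsub>A x\<^esub> v) = \<xi> x u ** \<xi> x v"
    using site_iso[of x] by (simp add: star_iso_def star_hom_def mat2_def)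
  then have "\<xi> x (\<one>\<^bsub>A x\<^esub> \<otimes>\<^bsub>A x\<^esub> a) = \<xi> x \<one>\<^bsub>A x\<^esub> ** \<xi> x a"
    using a(1) by blast
  then show ?thesis
    using a by simp
qed

lemma site_model: "matrix_model (A x) UNIV (site_mat x)"
proof -
  interpret unital_cstar_algebra "A x"
    by (rule site_algebra)
  have hom: "star_hom (A x) mat2 (\<xi> x)" and bij: "bij_betw (\<xi> x) (carrier (A x)) UNIV"
    using site_iso[of x] by (simp_all add: star_iso_def mat2_def)
  have entries: "bij_betw (\<lambda>m :: complex^2^2. \<lambda>i j. m $ i $ j) UNIV (carrier (mat_alg UNIV))"
    by (rule bij_betw_byWitness[where f' = "\<lambda>m. \<chi> i j. m i j"]) (auto simp: vec_eq_iff)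
  show ?thesis
  proof
    have "bij_betw (site_mat x) (carrier (A x)) (carrier (mat_alg UNIV))"
      using bij_betw_trans[OF bij entries] by (simp add: site_mat_def[abs_def] o_def)
    then show "star_iso (A x) (mat_alg UNIV) (site_mat x)"
      using hom unfolding star_iso_def star_hom_def
      by (auto simp: site_mat_def mat2_def matrix_matrix_mult_def)
    show "site_mat x \<one>\<^bsub>A x\<^esub> = \<one>\<^bsub>mat_alg UNIV\<^esub>"
      by (auto simp: site_mat_def site_one mat_def fun_eq_iff)
    show "c \<odot>\<^bsub>A x\<^esub> a \<in> carrier (A x)" if "a \<in> carrier (A x)" for c a
      using that by (intro smult_closed) (simp_all add: complex_ring_def)
  qed (simp_all add: star_closed)
qed

definition \<Phi> :: "int set \<Rightarrow> (int, 'a) tensor \<Rightarrow> (int \<Rightarrow> 2) \<Rightarrow> (int \<Rightarrow> 2) \<Rightarrow> complex" where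
  "\<Phi> L = tensor_mat L (\<lambda>_. UNIV) site_mat"

lemma local_tensor_model: "finite L \<Longrightarrow> tensor_model L A (\<lambda>_. UNIV) site_mat"
  by (simp add: tensor_model_def site_model)

lemma local_model: "finite L \<Longrightarrow> matrix_model (local_alg A L) (conf L) (\<Phi> L)"
  unfolding local_alg_def \<Phi>_def by (intro tensor_model.tensor_matrix_model local_tensor_model)

lemma mat_pure_tensor:
  assumes "finite L" "a \<in> tuples L A" "s \<in> conf L" "t \<in> conf L"
  shows "\<Phi> L (pure_tensor L A a) s t = (\<Prod>x\<in>L. site_mat x (a x) (s x) (t x))"
  using assms tensor_model.tensor_mat_pure[OF local_tensor_model]
  by (simp add: \<Phi>_def kron_def)

lemma local_pure_tensor_closed:
  "finite L \<Longrightarrow> a \<in> tuples L A \<Longrightarrow> pure_tensor L A a \<in> carrier (local_alg A L)"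
  unfolding local_alg_def by (rule tensor_model.pure_tensor_closed[OF local_tensor_model])

section \<open>The tensor product of two complementary regions\<close>

abbreviation "pair_alg L M \<equiv> case_bool (local_alg A L) (local_alg A (M - L))"
abbreviation "pair_conf L M \<equiv> case_bool (conf L) (conf (M - L)) :: bool \<Rightarrow> (int \<Rightarrow> 2) set"
abbreviation "pair_mat L M \<equiv> case_bool (\<Phi> L) (\<Phi> (M - L))"

definition glue :: "int set \<Rightarrow> int set \<Rightarrow> (bool \<Rightarrow> int \<Rightarrow> 2) \<Rightarrow> int \<Rightarrow> 2" where
  "glue L M w = (\<lambda>x\<in>M. w (x \<in> L) x)"

lemma pair_tensor_model:
  assumes "finite M" "L \<subseteq> M"
  shows "tensor_model UNIV (pair_alg L M) (pair_conf L M) (pair_mat L M)"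
  using assms by (auto simp: tensor_model_def local_model finite_subset split: bool.split)

lemma pair_confD:
  assumes "w \<in> Pi\<^sub>E UNIV (pair_conf L M)"
  shows "w True \<in> conf L" "w False \<in> conf (M - L)"
  using PiE_mem[OF assms, of True] PiE_mem[OF assms, of False] by simp_all

lemma glue_split:
  assumes "L \<subseteq> M" "s \<in> conf M"
  shows "glue L M (case_bool (restrict s L) (restrict s (M - L))) = s"
  using assms by (auto simp: glue_def fun_eq_iff PiE_iff extensional_def split: bool.split)

lemma split_mem: "case_bool (restrict s L) (restrict s (M - L)) \<in> Pi\<^sub>E UNIV (pair_conf L M)"
  by (auto split: bool.split)

lemma restrict_glue:
  assumes "L \<subseteq> M" "w \<in> Pi\<^sub>E UNIV (pair_conf L M)"
  shows "restrict (glue L M w) L = w True" "restrict (glue L M w) (M - L) = w False"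
  using assms(1) pair_confD[OF assms(2)]
  by (auto simp: glue_def fun_eq_iff PiE_iff extensional_def)

lemma bij_betw_glue:
  assumes "L \<subseteq> M"
  shows "bij_betw (glue L M) (Pi\<^sub>E UNIV (pair_conf L M)) (conf M)"
proof (rule bij_betw_byWitness[where f' = "\<lambda>s. case_bool (restrict s L) (restrict s (M - L))"])
  show "\<forall>w\<in>Pi\<^sub>E UNIV (pair_conf L M).
      case_bool (restrict (glue L M w) L) (restrict (glue L M w) (M - L)) = w"
  proof
    fix w assume "w \<in> Pi\<^sub>E UNIV (pair_conf L M)"
    then have "case_bool (restrict (glue L M w) L) (restrict (glue L M w) (M - L))
        = case_bool (w True) (w False)"
      by (simp only: restrict_glue[OF assms])
    then show "case_bool (restrict (glue L M w) L) (restrict (glue L M w) (M - L)) = w"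
      by (simp add: fun_eq_iff split: bool.split)
  qed
  show "glue L M ` Pi\<^sub>E UNIV (pair_conf L M) \<subseteq> conf M"
    by (auto simp: glue_def)
  show "(\<lambda>s. case_bool (restrict s L) (restrict s (M - L))) ` conf M \<subseteq> Pi\<^sub>E UNIV (pair_conf L M)"
    using split_mem by blast
qed (simp add: glue_split[OF assms])

lemma mat_pure_tensor2:
  assumes "finite M" "L \<subseteq> M" "X \<in> carrier (local_alg A L)" "Y \<in> carrier (local_alg A (M - L))"
    and w: "w \<in> Pi\<^sub>E UNIV (pair_conf L M)" "w' \<in> Pi\<^sub>E UNIV (pair_conf L M)"
  shows "tensor_mat UNIV (pair_conf L M) (pair_mat L M)
      (pure_tensor2 (local_alg A L) (local_alg A (M - L)) X Y) w w'
    = \<Phi> L X (w True) (w' True) * \<Phi> (M - L) Y (w False) (w' False)"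
proof -
  have "case_bool X Y \<in> tuples UNIV (pair_alg L M)"
    using assms by (auto simp: tuples_def split: bool.split)
  from tensor_model.tensor_mat_pure[OF pair_tensor_model[OF assms(1,2)] this] w
  show ?thesis
    by (simp add: pure_tensor2_def kron_def UNIV_bool mult.commute del: PiE_iff)
qed

lemma pure_tensor2_closed:
  assumes "finite M" "L \<subseteq> M" "X \<in> carrier (local_alg A L)" "Y \<in> carrier (local_alg A (M - L))"
  shows "pure_tensor2 (local_alg A L) (local_alg A (M - L)) X Y
    \<in> carrier (tensor2 (local_alg A L) (local_alg A (M - L)))"
  unfolding pure_tensor2_def tensor2_def
  by (rule tensor_model.pure_tensor_closed[OF pair_tensor_model[OF assms(1,2)]])
    (use assms in \<open>auto simp: tuples_def split: bool.split\<close>)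

text \<open>The definite description is resolved by giving an explicit map: both algebras have
  models over the same index set, hence are isomorphic by matching matrices. On pure tensors this is
  the required map because a product over \<open>M\<close> factors into products over
  \<open>L\<close> and \<open>M - L\<close>.\<close>

lemma splitting:
  assumes M: "finite M" "L \<subseteq> M"
  shows "star_iso (local_alg A M) (tensor2 (local_alg A L) (local_alg A (M - L))) (splitting A L M)"
      (is "star_iso ?M ?T2 _")
    and "X \<in> carrier (local_alg A M) \<Longrightarrow>
      tensor_mat UNIV (pair_conf L M) (pair_mat L M) (splitting A L M X)
      = reindex_mat (Pi\<^sub>E UNIV (pair_conf L M)) (glue L M) (\<Phi> M X)"
proof -
  let ?W = "Pi\<^sub>E UNIV (pair_conf L M)" and ?\<Phi>2 = "tensor_mat UNIV (pair_conf L M) (pair_mat L M)"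
  have fin: "finite L" "finite (M - L)"
    using M finite_subset by auto
  interpret T2: matrix_model ?T2 ?W ?\<Phi>2
    unfolding tensor2_def by (rule tensor_model.tensor_matrix_model[OF pair_tensor_model[OF M]])
  obtain p where p: "star_iso ?M ?T2 p"
    "\<And>X. X \<in> carrier ?M \<Longrightarrow> ?\<Phi>2 (p X) = reindex_mat ?W (glue L M) (\<Phi> M X)"
    "p \<in> extensional (carrier ?M)"
    \<comment> \<open>The model of the algebra of \<open>M\<close> is relabelled along
      \<open>glue\<close>, so that it too is indexed by pairs of configurations.\<close>
    using matrix_model_iso_exists[OF matrix_model_reindex[OF local_model[OF M(1)] bij_betw_glue[OF M(2)]]
        T2.matrix_model_axioms] by metis
  let ?pure = "\<lambda>a. pure_tensor2 (local_alg A L) (local_alg A (M - L))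
    (pure_tensor L A (restrict a L)) (pure_tensor (M - L) A (restrict a (M - L)))"
  have pure: "p (pure_tensor M A a) = ?pure a" if a: "a \<in> tuples M A" for a
  proof (rule T2.map_inj)
    have aL: "restrict a L \<in> tuples L A" "restrict a (M - L) \<in> tuples (M - L) A"
      using a M(2) by (auto simp: tuples_def)
    have closed: "pure_tensor L A (restrict a L) \<in> carrier (local_alg A L)"
      "pure_tensor (M - L) A (restrict a (M - L)) \<in> carrier (local_alg A (M - L))"
      "pure_tensor M A a \<in> carrier (local_alg A M)"
      using aL a fin M by (simp_all add: local_pure_tensor_closed)
    show "?pure a \<in> carrier ?T2"
      by (rule pure_tensor2_closed[OF M closed(1,2)])
    show "p (pure_tensor M A a) \<in> carrier ?T2"
      using p(1) closed(3) by (auto simp: star_iso_def star_hom_def)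
    show "?\<Phi>2 (p (pure_tensor M A a)) = ?\<Phi>2 (?pure a)"
    proof (intro ext)
      fix w w'
      show "?\<Phi>2 (p (pure_tensor M A a)) w w' = ?\<Phi>2 (?pure a) w w'"
      proof (cases "w \<in> ?W \<and> w' \<in> ?W")
        case True
        then have w: "w \<in> ?W" "w' \<in> ?W"
          by auto
        have glue: "glue L M w \<in> conf M" "glue L M w' \<in> conf M"
          using bij_betwE[OF bij_betw_glue[OF M(2)]] w by blast+
        let ?g = "\<lambda>x. site_mat x (a x) (glue L M w x) (glue L M w' x)"
        have "?\<Phi>2 (?pure a) w w'
            = (\<Prod>x\<in>L. site_mat x (a x) (w True x) (w' True x))
            * (\<Prod>x\<in>M - L. site_mat x (a x) (w False x) (w' False x))"
          by (simp add: mat_pure_tensor2[OF M closed(1,2) w] mat_pure_tensor fin aL pair_confD[OF w(1)]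
              pair_confD[OF w(2)] del: PiE_iff)
        also have "(\<Prod>x\<in>L. site_mat x (a x) (w True x) (w' True x)) = (\<Prod>x\<in>L. ?g x)"
          using M by (intro prod.cong) (auto simp: glue_def)
        also have "(\<Prod>x\<in>M - L. site_mat x (a x) (w False x) (w' False x)) = (\<Prod>x\<in>M - L. ?g x)"
          using M by (intro prod.cong) (auto simp: glue_def)
        also have "(\<Prod>x\<in>L. ?g x) * (\<Prod>x\<in>M - L. ?g x) = (\<Prod>x\<in>M. ?g x)"
          using prod.subset_diff[OF M(2) M(1), of ?g] by (simp add: mult.commute)
        also have "\<dots> = ?\<Phi>2 (p (pure_tensor M A a)) w w'"
          using w by (simp add: p(2)[OF closed(3)] reindex_mat_def mat_pure_tensor[OF M(1) a glue] del: PiE_iff)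
        finally show ?thesis ..
      next
        case False
        have "?\<Phi>2 (p (pure_tensor M A a)) \<in> carrier (mat_alg ?W)" "?\<Phi>2 (?pure a) \<in> carrier (mat_alg ?W)"
          by (intro T2.map_closed \<open>p (pure_tensor M A a) \<in> carrier ?T2\<close> \<open>?pure a \<in> carrier ?T2\<close>)+
        with False show ?thesis
          unfolding mat_alg_simps(1) by metis
      qed
    qed
  qed
  have "splitting A L M = p"
    unfolding splitting_def
  proof (rule the_equality)
    show "p \<in> extensional (carrier ?M) \<and> star_iso ?M ?T2 p \<and>
        (\<forall>a\<in>tuples M A. p (pure_tensor M A a) = ?pure a)"
      using p pure by blast
    fix q assume q: "q \<in> extensional (carrier ?M) \<and> star_iso ?M ?T2 q \<and>
        (\<forall>a\<in>tuples M A. q (pure_tensor M A a) = ?pure a)"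
    have "(conf M :: (int \<Rightarrow> 2) set) \<noteq> {}"
      by (simp add: PiE_eq_empty_iff)
    then show "q = p"
      using p(1,3) q pure
      by (intro tensor_model.star_iso_eqI[OF local_tensor_model[OF M(1)], of ?T2])
        (simp_all add: local_alg_def)
  qed
  with p show "star_iso ?M ?T2 (splitting A L M)"
    and "X \<in> carrier ?M \<Longrightarrow> ?\<Phi>2 (splitting A L M X) = reindex_mat ?W (glue L M) (\<Phi> M X)"
    by auto
qed

lemma isotony_mat:
  assumes M: "finite M" "L \<subseteq> M" and a: "a \<in> carrier (local_alg A L)"
  shows "isotony A M L a \<in> carrier (local_alg A M)" "\<Phi> M (isotony A M L a) = extend_mat L M (\<Phi> L a)"
proof -
  have fin: "finite L" "finite (M - L)"
    using M finite_subset by auto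
  interpret L: matrix_model "local_alg A L" "conf L" "\<Phi> L"
    by (rule local_model[OF fin(1)])
  interpret M: matrix_model "local_alg A M" "conf M" "\<Phi> M"
    by (rule local_model[OF M(1)])
  interpret D: matrix_model "local_alg A (M - L)" "conf (M - L)" "\<Phi> (M - L)"
    by (rule local_model[OF fin(2)])
  let ?W = "Pi\<^sub>E UNIV (pair_conf L M)" and ?\<Phi>2 = "tensor_mat UNIV (pair_conf L M) (pair_mat L M)"
  let ?t = "pure_tensor2 (local_alg A L) (local_alg A (M - L)) a \<one>\<^bsub>local_alg A (M - L)\<^esub>"
  define X where "X = isotony A M L a"
  have "X \<in> carrier (local_alg A M) \<and> \<Phi> M X = extend_mat L M (\<Phi> L a)"
  proof (cases "L = M")
    case True
    then show ?thesis
      using a extend_mat_self[OF L.map_closed[OF a]] by (simp add: X_def isotony_def)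
  next
    case False
    \<comment> \<open>Surjectivity of the splitting makes \<open>inv_into\<close> a genuine preimage
      of this pure tensor.\<close>
    have "?t \<in> splitting A L M ` carrier (local_alg A M)"
      using splitting(1)[OF M] pure_tensor2_closed[OF M a D.one_closed]
      by (simp add: star_iso_def bij_betw_def)
    then have X: "X \<in> carrier (local_alg A M)" "splitting A L M X = ?t"
      unfolding X_def isotony_def using False by (simp_all add: inv_into_into f_inv_into_f)
    have "\<Phi> M X s t = extend_mat L M (\<Phi> L a) s t" for s t
    proof (cases "s \<in> conf M \<and> t \<in> conf M")
      case True
      let ?s = "case_bool (restrict s L) (restrict s (M - L))"
        and ?u = "case_bool (restrict t L) (restrict t (M - L))"
      \<comment> \<open>A configuration on \<open>M\<close> is the gluing of its two restrictions,
        so the entry can be computed in \<open>tensor2\<close>. There the identity factor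
        contributes the agreement condition of \<open>extend_mat\<close>.\<close>
      have "\<Phi> M X s t = reindex_mat ?W (glue L M) (\<Phi> M X) ?s ?u"
        using True split_mem by (simp add: reindex_mat_def glue_split[OF M(2)] del: PiE_iff)
      also have "\<dots> = ?\<Phi>2 ?t ?s ?u"
        by (simp add: splitting(2)[OF M X(1), symmetric] X(2))
      also have "\<dots> = \<Phi> L a (restrict s L) (restrict t L)
          * \<Phi> (M - L) \<one>\<^bsub>local_alg A (M - L)\<^esub> (restrict s (M - L)) (restrict t (M - L))"
        by (simp add: mat_pure_tensor2[OF M a D.one_closed split_mem split_mem])
      also have "\<dots> = extend_mat L M (\<Phi> L a) s t"
        using True by (simp add: D.map_one extend_mat_def del: PiE_iff)
      finally show ?thesis .
    next
      case False
      then have "\<Phi> M X s t = 0"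
        using M.map_closed[OF X(1)] unfolding mat_alg_simps(1) by blast
      with False show ?thesis
        by (auto simp: extend_mat_def simp del: PiE_iff)
    qed
    with X(1) show ?thesis
      by blast
  qed
  then show "isotony A M L a \<in> carrier (local_alg A M)" "\<Phi> M (isotony A M L a) = extend_mat L M (\<Phi> L a)"
    by (simp_all add: X_def)
qed

end

section \<open>Closed operator algebras\<close>

lemma cring_complex_ring: "cring complex_ring"
proof (rule cringI)
  show "abelian_group complex_ring"
  proof (rule abelian_groupI)
    fix x assume "x \<in> carrier complex_ring"
    show "\<exists>y\<in>carrier complex_ring. y \<oplus>\<^bsub>complex_ring\<^esub> x = \<zero>\<^bsub>complex_ring\<^esub>"
      by (rule bexI[of _ "- x"]) (simp_all add: complex_ring_def)
  qed (simp_all add: complex_ring_def)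
  show "comm_monoid complex_ring"
    by (rule comm_monoidI) (simp_all add: complex_ring_def)
qed (simp add: complex_ring_def algebra_simps)

text \<open>The injection \<open>\<iota>\<close> only renames the operators; it moves the algebra into a
  prescribed element type.\<close>

locale operator_algebra =
  fixes S :: "('k l2 \<Rightarrow>\<^sub>L 'k l2) set" and \<iota> :: "('k l2 \<Rightarrow>\<^sub>L 'k l2) \<Rightarrow> 'b"
  assumes inj: "inj_on \<iota> S"
    and closed: "closed S"
    and id_mem: "id_blinfun \<in> S"
    and add_mem: "X \<in> S \<Longrightarrow> Y \<in> S \<Longrightarrow> X + Y \<in> S"
    and compose_mem: "X \<in> S \<Longrightarrow> Y \<in> S \<Longrightarrow> X o\<^sub>L Y \<in> S"
    and scalar_mem: "X \<in> S \<Longrightarrow> scalar_op c o\<^sub>L X \<in> S"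
    and scalar_commute: "X \<in> S \<Longrightarrow> X o\<^sub>L scalar_op c = scalar_op c o\<^sub>L X"
    and adjoint_mem: "X \<in> S \<Longrightarrow> \<exists>Y\<in>S. adjoint_pair X Y"
begin

abbreviation "\<rho> \<equiv> inv_into S \<iota>"

definition adj :: "('k l2 \<Rightarrow>\<^sub>L 'k l2) \<Rightarrow> 'k l2 \<Rightarrow>\<^sub>L 'k l2" where
  "adj X = (THE Y. adjoint_pair X Y)"

definition algebra :: "'b cstar_alg" where
  "algebra = \<lparr>carrier = \<iota> ` S, mult = \<lambda>x y. \<iota> (\<rho> x o\<^sub>L \<rho> y), one = \<iota> id_blinfun,
     zero = \<iota> 0, add = \<lambda>x y. \<iota> (\<rho> x + \<rho> y), smult = \<lambda>c x. \<iota> (scalar_op c o\<^sub>L \<rho> x),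
     star = \<lambda>x. \<iota> (adj (\<rho> x)), cnorm = \<lambda>x. norm (\<rho> x)\<rparr>"

lemma adj_eq: "adjoint_pair X Y \<Longrightarrow> adj X = Y"
  unfolding adj_def using adjoint_pair_unique by blast

lemma adj_mem: "X \<in> S \<Longrightarrow> adj X \<in> S"
  and adjoint_pair_adj: "X \<in> S \<Longrightarrow> adjoint_pair X (adj X)"
  using adjoint_mem adj_eq by metis+

lemma uminus_eq: "- X = scalar_op (- 1) o\<^sub>L X" for X :: "'k l2 \<Rightarrow>\<^sub>L 'k l2"
  by (intro blinfun_eqI l2_eqI) (simp add: blinfun.bilinear_simps)

lemma zero_mem: "0 \<in> S"
proof -
  have "scalar_op 0 o\<^sub>L id_blinfun = (0 :: 'k l2 \<Rightarrow>\<^sub>L 'k l2)"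
    by (intro blinfun_eqI l2_eqI) simp
  then show ?thesis
    using scalar_mem[OF id_mem, of 0] by simp
qed

lemma uminus_mem: "X \<in> S \<Longrightarrow> - X \<in> S"
  unfolding uminus_eq by (rule scalar_mem)

lemma diff_mem: "X \<in> S \<Longrightarrow> Y \<in> S \<Longrightarrow> X - Y \<in> S"
  using add_mem[OF _ uminus_mem] by fastforce

lemma algebra_simps [simp]:
  "carrier algebra = \<iota> ` S"
  "\<one>\<^bsub>algebra\<^esub> = \<iota> id_blinfun"
  "\<zero>\<^bsub>algebra\<^esub> = \<iota> 0"
  "X \<in> S \<Longrightarrow> Y \<in> S \<Longrightarrow> \<iota> X \<otimes>\<^bsub>algebra\<^esub> \<iota> Y = \<iota> (X o\<^sub>L Y)"
  "X \<in> S \<Longrightarrow> Y \<in> S \<Longrightarrow> \<iota> X \<oplus>\<^bsub>algebra\<^esub> \<iota> Y = \<iota> (X + Y)"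
  "X \<in> S \<Longrightarrow> c \<odot>\<^bsub>algebra\<^esub> \<iota> X = \<iota> (scalar_op c o\<^sub>L X)"
  "X \<in> S \<Longrightarrow> star algebra (\<iota> X) = \<iota> (adj X)"
  "X \<in> S \<Longrightarrow> cnorm algebra (\<iota> X) = norm X"
  using inj by (simp_all add: algebra_def)

lemma iota_eq_iff [simp]: "X \<in> S \<Longrightarrow> Y \<in> S \<Longrightarrow> \<iota> X = \<iota> Y \<longleftrightarrow> X = Y"
  using inj by (auto dest: inj_onD)

lemmas mems = id_mem add_mem compose_mem scalar_mem adj_mem zero_mem uminus_mem diff_mem

lemma abelian_group_algebra: "abelian_group algebra"
proof (rule abelian_groupI)
  fix x assume "x \<in> carrier algebra"
  then obtain X where "x = \<iota> X" "X \<in> S"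
    by auto
  then show "\<exists>y\<in>carrier algebra. y \<oplus>\<^bsub>algebra\<^esub> x = \<zero>\<^bsub>algebra\<^esub>"
    by (intro bexI[of _ "\<iota> (- X)"]) (simp_all add: mems)
qed (auto simp: mems add.assoc add.commute)

lemma ring_algebra: "ring algebra"
proof (rule ringI[OF abelian_group_algebra])
  show "monoid algebra"
    by (rule monoidI) (auto simp: mems compose_assoc compose_id)
qed (auto simp: mems bounded_bilinear.add_left[OF bounded_bilinear_blinfun_compose]
    bounded_bilinear.add_right[OF bounded_bilinear_blinfun_compose])

lemma algebra_uminus [simp]:
  assumes "X \<in> S"
  shows "\<ominus>\<^bsub>algebra\<^esub> \<iota> X = \<iota> (- X)"
  by (rule abelian_group.minus_equality[OF abelian_group_algebra]) (use assms in \<open>simp_all add: mems\<close>)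

lemma algebra_minus [simp]: "X \<in> S \<Longrightarrow> Y \<in> S \<Longrightarrow> \<iota> X \<ominus>\<^bsub>algebra\<^esub> \<iota> Y = \<iota> (X - Y)"
  by (simp add: a_minus_def mems)

lemma unital_star_algebra: "unital_star_algebra algebra"
proof (intro unital_star_algebra.intro module.intro)
  show "module_axioms complex_ring algebra"
  proof
    fix a b x assume "x \<in> carrier algebra"
    then show "(a \<oplus>\<^bsub>complex_ring\<^esub> b) \<odot>\<^bsub>algebra\<^esub> x = a \<odot>\<^bsub>algebra\<^esub> x \<oplus>\<^bsub>algebra\<^esub> b \<odot>\<^bsub>algebra\<^esub> x"
      by (auto simp: mems complex_ring_def scalar_op_add
          bounded_bilinear.add_left[OF bounded_bilinear_blinfun_compose])
  qed (auto simp: mems complex_ring_def scalar_op_one scalar_op_mult compose_id compose_assoc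
      bounded_bilinear.add_right[OF bounded_bilinear_blinfun_compose])
  have adj_add: "adj (X + Y) = adj X + adj Y" if "X \<in> S" "Y \<in> S" for X Y
    using that by (intro adj_eq adjoint_pair_add adjoint_pair_adj)
  have adj_compose: "adj (X o\<^sub>L Y) = adj Y o\<^sub>L adj X" if "X \<in> S" "Y \<in> S" for X Y
    using that by (intro adj_eq adjoint_pair_compose adjoint_pair_adj)
  \<comment> \<open>Taking adjoints reverses the composition and leaves the conjugate scalar on the
    right; complex linearity moves it back to the left.\<close>
  have adj_scalar: "adj (scalar_op c o\<^sub>L X) = scalar_op (cnj c) o\<^sub>L adj X" if "X \<in> S" for X c
    using adj_eq[OF adjoint_pair_compose[OF adjoint_pair_scalar[of c] adjoint_pair_adj[OF that]]]
    by (simp only: scalar_commute[OF adj_mem[OF that]])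
  have adj_adj: "adj (adj X) = X" if "X \<in> S" for X
    by (rule adj_eq[OF adjoint_pair_sym[OF adjoint_pair_adj[OF that]]])
  have scalar_right: "X o\<^sub>L (scalar_op c o\<^sub>L Y) = scalar_op c o\<^sub>L (X o\<^sub>L Y)" if "X \<in> S"
    for X Y :: "'k l2 \<Rightarrow>\<^sub>L 'k l2" and c
    by (metis compose_assoc scalar_commute[OF that])
  show "unital_star_algebra_axioms algebra"
    by standard (auto simp: mems adj_add adj_compose adj_scalar adj_adj compose_assoc scalar_right)
qed (simp_all add: ring_algebra cring_complex_ring abelian_group_algebra ring.axioms)

lemma unital_cstar_algebra: "unital_cstar_algebra algebra"
proof (rule unital_cstar_algebra.intro[OF unital_star_algebra], standard)
  fix x assume "x \<in> carrier algebra"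
  then show "cnorm algebra (star algebra x \<otimes>\<^bsub>algebra\<^esub> x) = (cnorm algebra x)\<^sup>2"
    by (auto simp: mems adjoint_pair_norm_square adjoint_pair_adj)
next
  fix s :: "nat \<Rightarrow> 'b"
  assume mem: "\<And>n. s n \<in> carrier algebra"
    and cauchy: "\<And>e. 0 < e \<Longrightarrow> \<exists>N. \<forall>m\<ge>N. \<forall>n\<ge>N. cnorm algebra (s m \<ominus>\<^bsub>algebra\<^esub> s n) < e"
  have "\<forall>n. \<exists>X. X \<in> S \<and> s n = \<iota> X"
    using mem by auto
  then obtain X where X: "\<And>n. X n \<in> S" "\<And>n. s n = \<iota> (X n)"
    by metis
  have "Cauchy X"
    using cauchy by (simp add: X mems Cauchy_def dist_norm)
  then obtain L where L: "X \<longlonglongrightarrow> L"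
    using Cauchy_convergent_iff convergent_def by blast
  \<comment> \<open>Bounded operators on a complete space are complete, so a limit exists;
    closedness of \<open>S\<close> keeps it in the algebra.\<close>
  then have "L \<in> S"
    using closed X(1) closed_sequentially by blast
  moreover have "(\<lambda>n. norm (X n - L)) \<longlonglongrightarrow> 0"
    by (rule tendsto_norm_zero[OF LIM_zero[OF L]])
  ultimately show "\<exists>l\<in>carrier algebra. (\<lambda>n. cnorm algebra (s n \<ominus>\<^bsub>algebra\<^esub> l)) \<longlonglongrightarrow> 0"
    by (intro bexI[of _ "\<iota> L"]) (simp_all add: X mems)
qed (auto simp: mems norm_triangle_ineq norm_scalar_op_compose norm_blinfun_compose)

end

section \<open>The quasilocal algebra\<close>

context spin_chain
begin

definition \<Psi> :: "int set \<Rightarrow> (int, 'a) tensor \<Rightarrow> (int \<Rightarrow> 2) l2 \<Rightarrow>\<^sub>L (int \<Rightarrow> 2) l2" where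
  "\<Psi> L a = loc_op L (\<Phi> L a)"

definition local_ops :: "int set \<Rightarrow> ((int \<Rightarrow> 2) l2 \<Rightarrow>\<^sub>L (int \<Rightarrow> 2) l2) set" where
  "local_ops L = \<Psi> L ` carrier (local_alg A L)"

lemma \<Psi>_hom:
  assumes "finite L"
  shows "\<Psi> L \<one>\<^bsub>local_alg A L\<^esub> = id_blinfun"
    and "a \<in> carrier (local_alg A L) \<Longrightarrow> b \<in> carrier (local_alg A L) \<Longrightarrow>
      \<Psi> L (a \<oplus>\<^bsub>local_alg A L\<^esub> b) = \<Psi> L a + \<Psi> L b"
    and "a \<in> carrier (local_alg A L) \<Longrightarrow> b \<in> carrier (local_alg A L) \<Longrightarrow>
      \<Psi> L (a \<otimes>\<^bsub>local_alg A L\<^esub> b) = \<Psi> L a o\<^sub>L \<Psi> L b"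
    and "a \<in> carrier (local_alg A L) \<Longrightarrow> \<Psi> L (c \<odot>\<^bsub>local_alg A L\<^esub> a) = scalar_op c o\<^sub>L \<Psi> L a"
    and "a \<in> carrier (local_alg A L) \<Longrightarrow> adjoint_pair (\<Psi> L a) (\<Psi> L (star (local_alg A L) a))"
proof -
  interpret matrix_model "local_alg A L" "conf L" "\<Phi> L"
    by (rule local_model[OF assms])
  note [simp del] = mat_alg_simps
  note simps = \<Psi>_def map_one map_add map_mult map_smult map_star loc_op_one loc_op_add loc_op_mult
    loc_op_smult assms
  show "\<Psi> L \<one>\<^bsub>local_alg A L\<^esub> = id_blinfun"
    by (simp add: simps)
  show "\<Psi> L (a \<oplus>\<^bsub>local_alg A L\<^esub> b) = \<Psi> L a + \<Psi> L b"
    "\<Psi> L (a \<otimes>\<^bsub>local_alg A L\<^esub> b) = \<Psi> L a o\<^sub>L \<Psi> L b"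
    if "a \<in> carrier (local_alg A L)" "b \<in> carrier (local_alg A L)"
    using that by (simp_all add: simps)
  show "\<Psi> L (c \<odot>\<^bsub>local_alg A L\<^esub> a) = scalar_op c o\<^sub>L \<Psi> L a"
    "adjoint_pair (\<Psi> L a) (\<Psi> L (star (local_alg A L) a))"
    if "a \<in> carrier (local_alg A L)"
    using that by (simp_all add: simps adjoint_pair_loc_op)
qed

lemma \<Psi>_inj: "finite L \<Longrightarrow> inj_on (\<Psi> L) (carrier (local_alg A L))"
proof (rule inj_onI)
  fix a b
  assume L: "finite L" and ab: "a \<in> carrier (local_alg A L)" "b \<in> carrier (local_alg A L)" "\<Psi> L a = \<Psi> L b"
  interpret matrix_model "local_alg A L" "conf L" "\<Phi> L"
    by (rule local_model[OF L])
  have "\<Phi> L a = \<Phi> L b"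
    using ab(3) unfolding \<Psi>_def by (rule inj_onD[OF loc_op_inj[OF L]]) (intro map_closed ab)+
  then show "a = b"
    using ab by (intro map_inj)
qed

lemma closed_local_ops: "finite L \<Longrightarrow> closed (local_ops L)"
proof -
  assume L: "finite L"
  interpret matrix_model "local_alg A L" "conf L" "\<Phi> L"
    by (rule local_model[OF L])
  have "\<Phi> L ` carrier (local_alg A L) = carrier (mat_alg (conf L))"
    using iso by (simp add: star_iso_def bij_betw_def)
  then have "local_ops L = loc_op L ` carrier (mat_alg (conf L))"
    unfolding local_ops_def \<Psi>_def by (metis image_image)
  then show ?thesis
    by (simp only: closed_loc_op_range[OF L])
qed

text \<open>On operators an isotony becomes an inclusion of sets. This gives the compatibility
  required of the isomorphisms, and it reduces the cocycle condition to a triviality.\<close>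

lemma \<Psi>_isotony:
  assumes "finite M" "L \<subseteq> M" "a \<in> carrier (local_alg A L)"
  shows "\<Psi> M (isotony A M L a) = \<Psi> L a"
  by (simp add: \<Psi>_def isotony_mat[OF assms] loc_op_extend_mat[OF assms(1,2)])

lemma family_of_isotonies: "family_of_isotonies (local_alg A) (isotony A)"
proof -
  have fin: "finite L" if "L \<in> Fin_int" for L
    using that by (simp add: Fin_int_def)
  have eqI: "a = b" if "\<Psi> M a = \<Psi> M b" "M \<in> Fin_int" "a \<in> carrier (local_alg A M)" "b \<in> carrier (local_alg A M)"
    for M a b
    using that \<Psi>_inj[OF fin] by (metis inj_onD)
  have hom: "star_hom (local_alg A L) (local_alg A M) (isotony A M L) \<and>
      inj_on (isotony A M L) (carrier (local_alg A L)) \<and>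
      isotony A M L \<one>\<^bsub>local_alg A L\<^esub> = \<one>\<^bsub>local_alg A M\<^esub>"
    if LM: "L \<in> Fin_int" "M \<in> Fin_int" "L \<subseteq> M" for L M
  proof -
    interpret L: matrix_model "local_alg A L" "conf L" "\<Phi> L"
      by (intro local_model fin LM)
    interpret M: matrix_model "local_alg A M" "conf M" "\<Phi> M"
      by (intro local_model fin LM)
    note \<Psi> = \<Psi>_isotony[OF fin[OF LM(2)] LM(3)] and closed = isotony_mat(1)[OF fin[OF LM(2)] LM(3)]
      and homL = \<Psi>_hom[OF fin[OF LM(1)]] and homM = \<Psi>_hom[OF fin[OF LM(2)]]
    let ?i = "isotony A M L"
    have "?i (a \<oplus>\<^bsub>local_alg A L\<^esub> b) = ?i a \<oplus>\<^bsub>local_alg A M\<^esub> ?i b"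
      "?i (a \<otimes>\<^bsub>local_alg A L\<^esub> b) = ?i a \<otimes>\<^bsub>local_alg A M\<^esub> ?i b"
      if "a \<in> carrier (local_alg A L)" "b \<in> carrier (local_alg A L)" for a b
      by (rule eqI[OF _ LM(2)]; use that in \<open>simp add: \<Psi> closed homL homM L.add_closed M.add_closed
          L.mult_closed M.mult_closed\<close>)+
    moreover have "?i (c \<odot>\<^bsub>local_alg A L\<^esub> a) = c \<odot>\<^bsub>local_alg A M\<^esub> ?i a"
      if "a \<in> carrier (local_alg A L)" for a c
      by (rule eqI[OF _ LM(2)]; use that in \<open>simp add: \<Psi> closed homL homM L.smult_closed M.smult_closed\<close>)
    moreover have "?i (star (local_alg A L) a) = star (local_alg A M) (?i a)"
      if a: "a \<in> carrier (local_alg A L)" for a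
    proof (rule eqI[OF _ LM(2)])
      \<comment> \<open>Both sides are adjoint to the operator of \<open>a\<close>, computed once in
        the region \<open>L\<close> and once in \<open>M\<close>, and adjoints are unique.\<close>
      show "\<Psi> M (?i (star (local_alg A L) a)) = \<Psi> M (star (local_alg A M) (?i a))"
        using homL(5)[OF a] homM(5)[OF closed[OF a]] a
        by (intro adjoint_pair_unique[of "\<Psi> L a"]) (simp_all add: \<Psi> L.star_closed)
    qed (use a in \<open>simp_all add: closed L.star_closed M.star_closed\<close>)
    moreover have "inj_on ?i (carrier (local_alg A L))"
      by (rule inj_onI) (metis \<Psi> eqI LM(1))
    moreover have "?i \<one>\<^bsub>local_alg A L\<^esub> = \<one>\<^bsub>local_alg A M\<^esub>"
      by (rule eqI[OF _ LM(2)]; simp add: \<Psi> closed homL homM L.one_closed M.one_closed)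
    ultimately show ?thesis
      using closed by (auto simp: star_hom_def)
  qed
  have "isotony A K M (isotony A M L a) = isotony A K L a"
    if "L \<in> Fin_int" "M \<in> Fin_int" "K \<in> Fin_int" "L \<subseteq> M" "M \<subseteq> K" "a \<in> carrier (local_alg A L)"
    for L M K a
  proof (rule eqI[OF _ \<open>K \<in> Fin_int\<close>])
    have "L \<subseteq> K"
      using that by blast
    then show "\<Psi> K (isotony A K M (isotony A M L a)) = \<Psi> K (isotony A K L a)"
      and "isotony A K M (isotony A M L a) \<in> carrier (local_alg A K)"
      and "isotony A K L a \<in> carrier (local_alg A K)"
      using that by (simp_all add: \<Psi>_isotony isotony_mat(1) fin)
  qed
  with hom show ?thesis
    unfolding family_of_isotonies_def by blast
qed

lemma local_ops_mono:
  assumes "finite M" "L \<subseteq> M"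
  shows "local_ops L \<subseteq> local_ops M"
proof
  fix X assume "X \<in> local_ops L"
  then obtain a where a: "a \<in> carrier (local_alg A L)" "X = \<Psi> L a"
    by (auto simp: local_ops_def)
  then have "X = \<Psi> M (isotony A M L a)"
    by (simp add: \<Psi>_isotony[OF assms])
  then show "X \<in> local_ops M"
    unfolding local_ops_def using isotony_mat(1)[OF assms a(1)] by blast
qed

lemma local_ops_closed:
  assumes "finite L"
  shows "id_blinfun \<in> local_ops L"
    and "X \<in> local_ops L \<Longrightarrow> Y \<in> local_ops L \<Longrightarrow> X + Y \<in> local_ops L"
    and "X \<in> local_ops L \<Longrightarrow> Y \<in> local_ops L \<Longrightarrow> X o\<^sub>L Y \<in> local_ops L"
    and "X \<in> local_ops L \<Longrightarrow> scalar_op c o\<^sub>L X \<in> local_ops L"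
    and "X \<in> local_ops L \<Longrightarrow> \<exists>Y\<in>local_ops L. adjoint_pair X Y"
proof -
  interpret matrix_model "local_alg A L" "conf L" "\<Phi> L"
    by (rule local_model[OF assms])
  note hom = \<Psi>_hom[OF assms]
  show "id_blinfun \<in> local_ops L"
    unfolding local_ops_def using hom(1) one_closed by (metis imageI)
  show "X + Y \<in> local_ops L" "X o\<^sub>L Y \<in> local_ops L" if XY: "X \<in> local_ops L" "Y \<in> local_ops L"
  proof -
    obtain a b where "a \<in> carrier (local_alg A L)" "X = \<Psi> L a" "b \<in> carrier (local_alg A L)" "Y = \<Psi> L b"
      using XY unfolding local_ops_def by blast
    then show "X + Y \<in> local_ops L" "X o\<^sub>L Y \<in> local_ops L"
      unfolding local_ops_def by (metis hom(2) add_closed imageI, metis hom(3) mult_closed imageI)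
  qed
  show "scalar_op c o\<^sub>L X \<in> local_ops L" "\<exists>Y\<in>local_ops L. adjoint_pair X Y" if X: "X \<in> local_ops L"
  proof -
    obtain a where "a \<in> carrier (local_alg A L)" "X = \<Psi> L a"
      using X unfolding local_ops_def by blast
    then show "scalar_op c o\<^sub>L X \<in> local_ops L" "\<exists>Y\<in>local_ops L. adjoint_pair X Y"
      unfolding local_ops_def by (metis hom(4) smult_closed imageI, metis hom(5) star_closed imageI)
  qed
qed

section \<open>The union of the local ranges and its closure\<close>

definition all_local :: "((int \<Rightarrow> 2) l2 \<Rightarrow>\<^sub>L (int \<Rightarrow> 2) l2) set" where
  "all_local = (\<Union>L\<in>Fin_int. local_ops L)"

text \<open>Two regions lie in their union, so sums and products of operators from different regions
  can be formed inside a single range.\<close>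

lemma all_local_directed:
  assumes "X \<in> all_local" "Y \<in> all_local"
  obtains L where "L \<in> Fin_int" "X \<in> local_ops L" "Y \<in> local_ops L"
proof -
  obtain L M where LM: "L \<in> Fin_int" "X \<in> local_ops L" "M \<in> Fin_int" "Y \<in> local_ops M"
    using assms by (auto simp: all_local_def)
  then have "L \<union> M \<in> Fin_int" "finite (L \<union> M)"
    by (auto simp: Fin_int_def)
  then show ?thesis
    using LM local_ops_mono[of "L \<union> M" L] local_ops_mono[of "L \<union> M" M] that[of "L \<union> M"] by blast
qed

lemma all_local_closed:
  "X \<in> all_local \<Longrightarrow> Y \<in> all_local \<Longrightarrow> X + Y \<in> all_local"
  "X \<in> all_local \<Longrightarrow> Y \<in> all_local \<Longrightarrow> X o\<^sub>L Y \<in> all_local"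
  "X \<in> all_local \<Longrightarrow> scalar_op c o\<^sub>L X \<in> all_local"
  "X \<in> all_local \<Longrightarrow> \<exists>Y\<in>all_local. adjoint_pair X Y"
proof -
  have fin: "finite L" "local_ops L \<subseteq> all_local" if "L \<in> Fin_int" for L
    using that by (auto simp: Fin_int_def all_local_def)
  show "X + Y \<in> all_local" "X o\<^sub>L Y \<in> all_local" if XY: "X \<in> all_local" "Y \<in> all_local"
  proof -
    obtain L where "L \<in> Fin_int" "X \<in> local_ops L" "Y \<in> local_ops L"
      using all_local_directed[OF XY] .
    then show "X + Y \<in> all_local" "X o\<^sub>L Y \<in> all_local"
      using fin[of L] local_ops_closed(2,3)[of L X Y] by blast+
  qed
  show "scalar_op c o\<^sub>L X \<in> all_local" "\<exists>Y\<in>all_local. adjoint_pair X Y" if X: "X \<in> all_local"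
  proof -
    obtain L where "L \<in> Fin_int" "X \<in> local_ops L"
      using X by (auto simp: all_local_def)
    then show "scalar_op c o\<^sub>L X \<in> all_local" "\<exists>Y\<in>all_local. adjoint_pair X Y"
      using fin[of L] local_ops_closed(4,5)[of L X] by blast+
  qed
qed

text \<open>Limits are unique, so an operator in the closure is determined by the sequences of
  local elements that converge to it; this moves the closure into the type \<^typ>\<open>'a quasilocal\<close>.\<close>

definition encode :: "((int \<Rightarrow> 2) l2 \<Rightarrow>\<^sub>L (int \<Rightarrow> 2) l2) \<Rightarrow> 'a quasilocal" where
  "encode X = {s. (\<forall>n. fst (s n) \<in> Fin_int \<and> snd (s n) \<in> carrier (local_alg A (fst (s n)))) \<and>
     (\<lambda>n. \<Psi> (fst (s n)) (snd (s n))) \<longlonglongrightarrow> X}"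

lemma inj_encode: "inj_on encode (closure all_local)"
proof (rule inj_onI)
  fix X Y assume "X \<in> closure all_local" and eq: "encode X = encode Y"
  then obtain x where x: "\<And>n. x n \<in> all_local" "x \<longlonglongrightarrow> X"
    unfolding closure_sequential by blast
  have "\<forall>n. \<exists>r. fst r \<in> Fin_int \<and> snd r \<in> carrier (local_alg A (fst r)) \<and> x n = \<Psi> (fst r) (snd r)"
    using x(1) by (fastforce simp: all_local_def local_ops_def)
  then obtain s where s: "\<And>n. fst (s n) \<in> Fin_int \<and> snd (s n) \<in> carrier (local_alg A (fst (s n))) \<and>
      x n = \<Psi> (fst (s n)) (snd (s n))"
    by metis
  have "x = (\<lambda>n. \<Psi> (fst (s n)) (snd (s n)))"
    using s by blast
  then have "s \<in> encode X"
    using s x(2) by (simp add: encode_def)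
  then have "(\<lambda>n. \<Psi> (fst (s n)) (snd (s n))) \<longlonglongrightarrow> X" "(\<lambda>n. \<Psi> (fst (s n)) (snd (s n))) \<longlonglongrightarrow> Y"
    using eq by (auto simp: encode_def)
  then show "X = Y"
    by (rule LIMSEQ_unique)
qed

text \<open>All properties pass to limits of sequences of local operators. Sums and compositions are
  continuous; for adjoints, convergence of the adjoint sequence is itself part of the claim and
  comes from \<open>adjoint_pair_limit\<close>.\<close>

lemma operator_algebra_closure: "operator_algebra (closure all_local) encode"
proof
  have fin: "finite L" if "L \<in> Fin_int" for L
    using that by (simp add: Fin_int_def)
  have "{0} \<in> Fin_int"
    by (simp add: Fin_int_def)
  then have "id_blinfun \<in> all_local"
    using local_ops_closed(1)[OF fin] by (auto simp: all_local_def)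
  then show "id_blinfun \<in> closure all_local"
    using closure_subset by blast
  note comp = bounded_bilinear.tendsto[OF bounded_bilinear_blinfun_compose]
  fix X :: "(int \<Rightarrow> 2) l2 \<Rightarrow>\<^sub>L (int \<Rightarrow> 2) l2" assume "X \<in> closure all_local"
  then obtain x where x: "\<And>n. x n \<in> all_local" "x \<longlonglongrightarrow> X"
    unfolding closure_sequential by blast
  show "X + Y \<in> closure all_local" "X o\<^sub>L Y \<in> closure all_local" if "Y \<in> closure all_local" for Y
  proof -
    obtain y where y: "\<And>n. y n \<in> all_local" "y \<longlonglongrightarrow> Y"
      using \<open>Y \<in> closure all_local\<close> unfolding closure_sequential by blast
    show "X + Y \<in> closure all_local"
      unfolding closure_sequential
      by (intro exI[of _ "\<lambda>n. x n + y n"] conjI allI all_local_closed x y tendsto_add)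
    show "X o\<^sub>L Y \<in> closure all_local"
      unfolding closure_sequential
      by (intro exI[of _ "\<lambda>n. x n o\<^sub>L y n"] conjI allI all_local_closed x y comp)
  qed
  show "scalar_op c o\<^sub>L X \<in> closure all_local" for c
    unfolding closure_sequential
    by (intro exI[of _ "\<lambda>n. scalar_op c o\<^sub>L x n"] conjI allI all_local_closed x comp tendsto_const)
  \<comment> \<open>Both sides are limits of the same sequence, since local operators are
    complex-linear.\<close>
  show "X o\<^sub>L scalar_op c = scalar_op c o\<^sub>L X" for c
  proof (rule LIMSEQ_unique)
    have "x n o\<^sub>L scalar_op c = scalar_op c o\<^sub>L x n" for n
      using x(1)[of n] by (auto simp: all_local_def local_ops_def \<Psi>_def loc_op_scalar_commute fin)
    then show "(\<lambda>n. x n o\<^sub>L scalar_op c) \<longlonglongrightarrow> (scalar_op c o\<^sub>L X)"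
      using comp[OF tendsto_const x(2), of "scalar_op c"] by simp
    show "(\<lambda>n. x n o\<^sub>L scalar_op c) \<longlonglongrightarrow> (X o\<^sub>L scalar_op c)"
      by (rule comp[OF x(2) tendsto_const])
  qed
  have "\<forall>n. \<exists>y. y \<in> all_local \<and> adjoint_pair (x n) y"
    using all_local_closed(4)[OF x(1)] by blast
  then obtain y where y: "\<And>n. y n \<in> all_local" "\<And>n. adjoint_pair (x n) (y n)"
    by metis
  from adjoint_pair_limit[OF x(2) y(2)] obtain Y where "y \<longlonglongrightarrow> Y" "adjoint_pair X Y" .
  moreover from this have "Y \<in> closure all_local"
    unfolding closure_sequential using y(1) by blast
  ultimately show "\<exists>Y\<in>closure all_local. adjoint_pair X Y"
    by blast
qed (simp_all add: inj_encode)

sublocale quasi: operator_algebra "closure all_local" encode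
  by (rule operator_algebra_closure)

section \<open>Local subalgebras, their isomorphisms and density\<close>

lemma local_ops_subset: "L \<in> Fin_int \<Longrightarrow> local_ops L \<subseteq> closure all_local"
  using closure_subset by (fastforce simp: all_local_def)

lemma subalgebra:
  assumes "L \<in> Fin_int"
  shows "unital_cstar_subalgebra (encode ` local_ops L) quasi.algebra"
proof -
  have fin: "finite L"
    using assms by (simp add: Fin_int_def)
  note closed = local_ops_closed[OF fin]
  have mem: "X \<in> closure all_local" if "X \<in> local_ops L" for X
    using that local_ops_subset[OF assms] by blast
  have adj: "quasi.adj X \<in> local_ops L" if "X \<in> local_ops L" for X
    using closed(5)[OF that] quasi.adj_eq by metis
  have "subring (encode ` local_ops L) quasi.algebra"
  proof (rule ring.subringI[OF quasi.ring_algebra])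
    show "\<ominus>\<^bsub>quasi.algebra\<^esub> h \<in> encode ` local_ops L" if "h \<in> encode ` local_ops L" for h
      using that closed(4)[of _ "- 1"] by (auto simp: mem quasi.uminus_eq)
  qed (use closed in \<open>auto simp: mem\<close>)
  moreover have "norm_closure quasi.algebra (encode ` local_ops L) \<subseteq> encode ` local_ops L"
  proof
    fix x assume "x \<in> norm_closure quasi.algebra (encode ` local_ops L)"
    then obtain X where X: "X \<in> closure all_local" "x = encode X"
      and "\<forall>e>0. \<exists>Y\<in>local_ops L. norm (X - Y) < e"
      by (auto simp: norm_closure_def mem quasi.mems)
    \<comment> \<open>Since \<open>encode\<close> transports the operator norm,
      \<open>norm_closure\<close> becomes the metric closure, and the local range is closed by
      \<open>closed_local_ops\<close>.\<close>
    then have "X \<in> closure (local_ops L)"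
      by (simp add: closure_approachable dist_norm norm_minus_commute)
    then show "x \<in> encode ` local_ops L"
      using X closed_local_ops[OF fin] by simp
  qed
  ultimately show ?thesis
    unfolding unital_cstar_subalgebra_def using closed(4) adj by (auto simp: mem)
qed

lemma local_iso:
  assumes "L \<in> Fin_int"
  shows "star_iso (local_alg A L) (quasi.algebra\<lparr>carrier := encode ` local_ops L\<rparr>) (\<lambda>a. encode (\<Psi> L a))"
proof -
  have fin: "finite L"
    using assms by (simp add: Fin_int_def)
  have mem: "\<Psi> L a \<in> closure all_local" if "a \<in> carrier (local_alg A L)" for a
    using that local_ops_subset[OF assms] by (auto simp: local_ops_def)
  have "inj_on (\<lambda>a. encode (\<Psi> L a)) (carrier (local_alg A L))"
    using \<Psi>_inj[OF fin] by (auto simp: inj_on_def mem)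
  moreover have "(\<lambda>a. encode (\<Psi> L a)) ` carrier (local_alg A L) = encode ` local_ops L"
    by (auto simp: local_ops_def)
  moreover have "quasi.adj (\<Psi> L a) = \<Psi> L (star (local_alg A L) a)" if "a \<in> carrier (local_alg A L)" for a
    by (rule quasi.adj_eq[OF \<Psi>_hom(5)[OF fin that]])
  ultimately show ?thesis
    unfolding star_iso_def star_hom_def bij_betw_def by (auto simp: \<Psi>_hom[OF fin] mem)
qed

lemma carrier_eq_norm_closure:
  "carrier quasi.algebra = norm_closure quasi.algebra (\<Union>L\<in>Fin_int. encode ` local_ops L)"
proof -
  have mem: "X \<in> closure all_local" if "X \<in> all_local" for X
    using that closure_subset by blast
  have "\<exists>y\<in>encode ` all_local. cnorm quasi.algebra (encode X \<ominus>\<^bsub>quasi.algebra\<^esub> y) < e"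
    if X: "X \<in> closure all_local" and "0 < e" for X e
  proof -
    obtain Y where "Y \<in> all_local" "norm (Y - X) < e"
      using X \<open>0 < e\<close> unfolding closure_approachable dist_norm by blast
    then show ?thesis
      using X by (intro bexI[of _ "encode Y"]) (simp_all add: mem quasi.diff_mem norm_minus_commute)
  qed
  moreover have "(\<Union>L\<in>Fin_int. encode ` local_ops L) = encode ` all_local"
    by (auto simp: all_local_def)
  ultimately show ?thesis
    unfolding norm_closure_def by auto
qed

end

theorem proposition15:
  fixes A :: "int \<Rightarrow> 'a cstar_alg" and \<xi> :: "int \<Rightarrow> 'a \<Rightarrow> complex^2^2"
  assumes "\<And>x. unital_cstar_algebra (A x)"
    and "\<And>x. star_iso (A x) mat2 (\<xi> x)"
  shows "family_of_isotonies (local_alg A) (isotony A) \<and>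
    (\<exists>(B :: 'a quasilocal cstar_alg) (C :: int set \<Rightarrow> 'a quasilocal set)
       (\<phi> :: int set \<Rightarrow> (int, 'a) tensor \<Rightarrow> 'a quasilocal).
       unital_cstar_algebra B \<and>
       (\<forall>L\<in>Fin_int. unital_cstar_subalgebra (C L) B) \<and>
       (\<forall>L\<in>Fin_int. \<forall>M\<in>Fin_int. L \<subseteq> M \<longrightarrow> C L \<subseteq> C M) \<and>
       (\<forall>L\<in>Fin_int. star_iso (local_alg A L) (B\<lparr>carrier := C L\<rparr>) (\<phi> L)) \<and>
       (\<forall>L\<in>Fin_int. \<forall>M\<in>Fin_int. L \<subseteq> M \<longrightarrow>
          (\<forall>a\<in>carrier (local_alg A L). \<phi> M (isotony A M L a) = \<phi> L a)) \<and>
       carrier B = norm_closure B (\<Union>L\<in>Fin_int. C L))"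
proof -
  interpret spin_chain A \<xi>
    by (rule spin_chain.intro) (rule assms)+
  have fin: "finite L" if "L \<in> Fin_int" for L
    using that by (simp add: Fin_int_def)
  show ?thesis
  \<comment> \<open>The three witnesses stay schematic and are fixed by unification with the
    statements shown: the closure of the union of local ranges, the encoded ranges themselves, and
    the encoded representations.\<close>
  proof (intro conjI exI)
    show "\<forall>L\<in>Fin_int. \<forall>M\<in>Fin_int. L \<subseteq> M \<longrightarrow> encode ` local_ops L \<subseteq> encode ` local_ops M"
      using local_ops_mono[OF fin] by (meson image_mono)
    show "\<forall>L\<in>Fin_int. \<forall>M\<in>Fin_int. L \<subseteq> M \<longrightarrow>
        (\<forall>a\<in>carrier (local_alg A L). encode (\<Psi> M (isotony A M L a)) = encode (\<Psi> L a))"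
      using \<Psi>_isotony[OF fin] by simp
    show "family_of_isotonies (local_alg A) (isotony A)"
      by (rule family_of_isotonies)
    show "unital_cstar_algebra quasi.algebra"
      by (rule quasi.unital_cstar_algebra)
    show "\<forall>L\<in>Fin_int. unital_cstar_subalgebra (encode ` local_ops L) quasi.algebra"
      by (intro ballI subalgebra)
    show "\<forall>L\<in>Fin_int. star_iso (local_alg A L) (quasi.algebra\<lparr>carrier := encode ` local_ops L\<rparr>)
        (\<lambda>a. encode (\<Psi> L a))"
      by (intro ballI local_iso)
    show "carrier quasi.algebra = norm_closure quasi.algebra (\<Union>L\<in>Fin_int. encode ` local_ops L)"
      by (rule carrier_eq_norm_closure)
  qed
qed

end
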